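(* Let $(\Xi^n)_{n\ge 0}$ be generated by an edge iterated graph system satisfying the standing assumptions (canonical, distance-positive, degree-primitive, single-edge initial graph). Then $\Xi$ is recurrent if and only if $\rho(\Psi)>1$.
   Context: **EIGS.** Fix $K\ge1$ colours $[K]=\{1,\dots,K\}$. An edge iterated graph system (EIGS) consists of finite directed rule graphs $R_1,\dots,R_K$ whose edges are coloured by a map $\mathscr C$ with values in $[K]$, each $R_i$ having two distinct planting vertices $\beta_i^+\ne\beta_i^-$, and an initial graph $\Xi^0$, which is a single directed edge of some colour with endpoints $\mathfrak v_+,\mathfrak v_-$. Given $\Xi^n$, the graph $\Xi^{n+1}$ is obtained by simultaneously replacing every directed edge $e=(a,b)$ of colour $i$ by a fresh copy of $R_i$, identifying $a\equiv\beta_i^+$, $b\equiv\beta_i^-$, with no other identifications. Thus $V(\Xi^n)\subset V(\Xi^{n+1})$, and $\Xi$ is the combinatorial limit with $V(\Xi)=\bigcup_nV(\Xi^n)$. Distances $d_G$, degrees, paths, balls $B_G(v,r)=\{u:d_G(v,u)<r\}$ and resistances refer to underlying undirected graphs, which are assumed simple and connected. **Matrices.** $\mathbf N\in\mathbb N^{2K\times2K}$ has rows $\kappa_{R_1}(\beta_1^+),\kappa_{R_1}(\beta_1^-),\dots,\kappa_{R_K}(\beta_K^+),\kappa_{R_K}(\beta_K^-)$, where $[\kappa_G(v)]_{2j-1}$ (resp. $[\kappa_G(v)]_{2j}$) is the number of $j$-coloured edges of $G$ leaving (resp. entering) $v$. $\mathcal D$ is the finite set of $K\times K$ matrices obtained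 by choosing, for each $i$, a simple path in $R_i$ between $\beta_i^+$ and $\beta_i^-$ and letting the $(i,j)$ entry be the number of $j$-coloured edges on the chosen path. **Resistance map.** For $\mathbf x\in(0,\infty)^K$, $[\Psi(\mathbf x)]_i$ is the effective resistance between $\beta_i^+$ and $\beta_i^-$ in $R_i$ when each $j$-coloured edge has resistance $[\mathbf x]_j$. There is a unique $\rho(\Psi)>0$ for which $\Psi(\mathbf v)=\rho(\Psi)\mathbf v$ has a solution $\mathbf v\in(0,\infty)^K$. **Standing assumptions.** (1) Canonical: every edge of every $R_i$ lies on a simple path joining $\beta_i^+$ and $\beta_i^-$. (2) Distance-positive: all matrices in $\mathcal D$ have positive entries; if $K=1$, additionally $d_{R_1}(\beta_1^+,\beta_1^-)\ge2$. (3) $\mathbf N$ is primitive. (4) $\Xi^0$ is a single edge. **Recurrence.** For a finite graph $G$, $v\in V(G)$ and $A\subseteq V(G)$, $\mathscr R_G(v,A^{\mathrm c})=\bigl(\inf\{\sum_{\{u,w\}\in E(G)}(f(u)-f(w))^2:f(v)=1,\ f\equiv0\text{ on }A^{\mathrm c}\}\bigr)^{-1}$. $\Xi$ is called recurrent if for every $v\in V(\Xi)$ and every $r_*\in(0,1)$, $$\liminf_{n\to\infty}\mathscr R_{\Xi^n}\Bigl(v,B_{\Xi^n}\bigl(v,r_*\max_{w\in V(\Xi^n)}d_{\Xi^n}(v,w)\bigr)^{\mathrm c}\Bigr)=\infty.$$ *)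

theory Defs
  imports "HOL-Analysis.Analysis" "Graph_Theory.Graph_Theory"
begin

abbreviation undir :: "('v, 'e) pre_digraph \<Rightarrow> ('v, 'v \<times> 'v) pre_digraph" where
  "undir G \<equiv> with_proj (mk_symmetric G)"

definition simple_undir :: "('v, 'e) pre_digraph \<Rightarrow> bool" where
  "simple_undir G \<longleftrightarrow>
     (\<forall>e\<in>arcs G. tail G e \<noteq> head G e) \<and> inj_on (\<lambda>e. {tail G e, head G e}) (arcs G)"

definition graph_dist :: "('v, 'e) pre_digraph \<Rightarrow> 'v \<Rightarrow> 'v \<Rightarrow> nat" where
  "graph_dist G u v = Inf (length ` {p. pre_digraph.awalk (undir G) u p v})"

definition graph_ball :: "('v, 'e) pre_digraph \<Rightarrow> 'v \<Rightarrow> real \<Rightarrow> 'v set" where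
  "graph_ball G v r = {u \<in> verts G. real (graph_dist G v u) < r}"

text \<open>An undirected path traverses the arc \<open>e\<close> along or against its orientation.\<close>

definition arcs_on :: "('v, 'e) pre_digraph \<Rightarrow> ('v \<times> 'v) awalk \<Rightarrow> 'e set" where
  "arcs_on G p =
     {e \<in> arcs G. (tail G e, head G e) \<in> set p \<or> (head G e, tail G e) \<in> set p}"

text \<open>Summing over arcs is summing over undirected edges: in a simple graph they correspond
  bijectively, and each summand is independent of the orientation. The resistance is
  extended-real valued, so that an infimum of \<open>0\<close> gives \<open>\<infinity>\<close> and an infimum over no
  admissible function (\<open>\<infinity>\<close>) gives \<open>0\<close>.\<close>

definition energy :: "('v, 'e) pre_digraph \<Rightarrow> ('e \<Rightarrow> real) \<Rightarrow> ('v \<Rightarrow> real) \<Rightarrow> real" where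
  "energy G r f = (\<Sum>e\<in>arcs G. (f (tail G e) - f (head G e))\<^sup>2 / r e)"

definition eff_resistance ::
    "('v, 'e) pre_digraph \<Rightarrow> ('e \<Rightarrow> real) \<Rightarrow> 'v set \<Rightarrow> 'v set \<Rightarrow> ereal" where
  "eff_resistance G r S T =
     inverse (INF f\<in>{f. (\<forall>x\<in>S. f x = 1) \<and> (\<forall>x\<in>T. f x = 0)}. ereal (energy G r f))"


text \<open>\<open>K = CARD('k)\<close>. The endpoints of the initial edge are called \<open>V_plus\<close> and \<open>V_minus\<close>
  in the datatype below, in the order of its direction, so only its colour is left to specify.\<close>

record ('v, 'e, 'k) eigs_data =
  rule :: "'k \<Rightarrow> ('v, 'e) pre_digraph"
  colour :: "'k \<Rightarrow> 'e \<Rightarrow> 'k"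
  bplus :: "'k \<Rightarrow> 'v"
  bminus :: "'k \<Rightarrow> 'v"
  init_colour :: 'k

definition eigs :: "('v, 'e, 'k::finite) eigs_data \<Rightarrow> bool" where
  "eigs S \<longleftrightarrow> (\<forall>i.
     fin_digraph (rule S i) \<and> simple_undir (rule S i) \<and>
     Digraph_Component.connected (rule S i) \<and>
     bplus S i \<in> verts (rule S i) \<and> bminus S i \<in> verts (rule S i) \<and> bplus S i \<noteq> bminus S i)"

text \<open>An arc of \<open>\<Xi>\<^sup>n\<close> is a list of length \<open>n\<close>: \<open>e # w\<close> is the arc \<open>e\<close> of the copy of the rule
  graph that replaces the arc \<open>w\<close> of the previous graph, and \<open>Inner w x\<close> is the vertex of that
  copy coming from the non-planting vertex \<open>x\<close>. The length of \<open>w\<close> records the level, so vertices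
  added at different levels never coincide.\<close>

datatype ('v, 'e) xvertex = V_plus | V_minus | Inner "'e list" 'v

fun arc_colour :: "('v, 'e, 'k) eigs_data \<Rightarrow> 'e list \<Rightarrow> 'k" where
  "arc_colour S [] = init_colour S"
| "arc_colour S (e # w) = colour S (arc_colour S w) e"

definition plant :: "('v, 'e, 'k) eigs_data \<Rightarrow> (('v, 'e) xvertex, 'e list) pre_digraph \<Rightarrow>
    'e list \<Rightarrow> 'v \<Rightarrow> ('v, 'e) xvertex" where
  "plant S G w x =
     (if x = bplus S (arc_colour S w) then tail G w
      else if x = bminus S (arc_colour S w) then head G w
      else Inner w x)"

fun Xi :: "('v, 'e, 'k) eigs_data \<Rightarrow> nat \<Rightarrow> (('v, 'e) xvertex, 'e list) pre_digraph" where
  "Xi S 0 =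
     \<lparr>verts = {V_plus, V_minus}, arcs = {[]}, tail = (\<lambda>_. V_plus), head = (\<lambda>_. V_minus)\<rparr>"
| "Xi S (Suc n) =
     (let G = Xi S n; R = (\<lambda>w. rule S (arc_colour S w)) in
      \<lparr>verts = verts G \<union> (\<Union>w\<in>arcs G. plant S G w ` verts (R w)),
       arcs = {e # w | e w. w \<in> arcs G \<and> e \<in> arcs (R w)},
       tail = (\<lambda>u. plant S G (tl u) (tail (R (tl u)) (hd u))),
       head = (\<lambda>u. plant S G (tl u) (head (R (tl u)) (hd u)))\<rparr>)"

definition Xi_verts :: "('v, 'e, 'k) eigs_data \<Rightarrow> ('v, 'e) xvertex set" where
  "Xi_verts S = (\<Union>n. verts (Xi S n))"


definition canonical :: "('v, 'e, 'k::finite) eigs_data \<Rightarrow> bool" where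
  "canonical S \<longleftrightarrow> (\<forall>i. \<forall>e\<in>arcs (rule S i). \<exists>p.
     pre_digraph.apath (undir (rule S i)) (bplus S i) p (bminus S i) \<and> e \<in> arcs_on (rule S i) p)"

definition path_matrices :: "('v, 'e, 'k::finite) eigs_data \<Rightarrow> (nat^'k^'k) set" where
  "path_matrices S =
     {\<chi> i j. card {e \<in> arcs_on (rule S i) (p i). colour S i e = j} | p.
        \<forall>i. pre_digraph.apath (undir (rule S i)) (bplus S i) (p i) (bminus S i)}"

definition distance_positive :: "('v, 'e, 'k::finite) eigs_data \<Rightarrow> bool" where
  "distance_positive S \<longleftrightarrow>
     (\<forall>M\<in>path_matrices S. \<forall>i j. 0 < M $ i $ j) \<and>
     (CARD('k) = 1 \<longrightarrow> (\<forall>i. 2 \<le> graph_dist (rule S i) (bplus S i) (bminus S i)))"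

text \<open>The index set \<open>'k \<times> bool\<close> has \<open>2 K\<close> elements; rows \<open>(i, True)\<close> and \<open>(i, False)\<close> belong to
  the two planting vertices, columns \<open>(j, True)\<close> and \<open>(j, False)\<close> to leaving and entering
  arcs of colour \<open>j\<close>.\<close>

definition degree_vector ::
    "('v, 'e) pre_digraph \<Rightarrow> ('e \<Rightarrow> 'k) \<Rightarrow> 'v \<Rightarrow> nat^('k::finite \<times> bool)" where
  "degree_vector G c v = (\<chi> a.
     card {e \<in> (if snd a then out_arcs G v else in_arcs G v). c e = fst a})"

definition degree_matrix ::
    "('v, 'e, 'k::finite) eigs_data \<Rightarrow> nat^('k \<times> bool)^('k \<times> bool)" where
  "degree_matrix S = (\<chi> a.
     degree_vector (rule S (fst a)) (colour S (fst a))
       (if snd a then bplus S (fst a) else bminus S (fst a)))"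

text \<open>The type of vectors carries a componentwise multiplication, so \<open>A ^ m\<close> would not be the
  matrix power.\<close>

definition primitive_matrix :: "nat^'n^'n \<Rightarrow> bool" where
  "primitive_matrix A \<longleftrightarrow> (\<exists>m>0. \<forall>i j. 0 < (((**) A ^^ m) (mat 1)) $ i $ j)"

definition degree_primitive :: "('v, 'e, 'k::finite) eigs_data \<Rightarrow> bool" where
  "degree_primitive S \<longleftrightarrow> primitive_matrix (degree_matrix S)"


definition resistance_map :: "('v, 'e, 'k::finite) eigs_data \<Rightarrow> real^'k \<Rightarrow> real^'k" where
  "resistance_map S x = (\<chi> i. real_of_ereal
     (eff_resistance (rule S i) (\<lambda>e. x $ colour S i e) {bplus S i} {bminus S i}))"

definition positive_eigenvalue :: "(real^'k \<Rightarrow> real^'k) \<Rightarrow> real" where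
  "positive_eigenvalue F = (THE \<rho>. 0 < \<rho> \<and> (\<exists>x. (\<forall>i. 0 < x $ i) \<and> F x = \<rho> *\<^sub>R x))"

definition recurrent :: "('v, 'e, 'k) eigs_data \<Rightarrow> bool" where
  "recurrent S \<longleftrightarrow> (\<forall>v\<in>Xi_verts S. \<forall>r::real. 0 < r \<and> r < 1 \<longrightarrow>
     liminf (\<lambda>n. let G = Xi S n in
       eff_resistance G (\<lambda>_. 1) {v}
         (verts G - graph_ball G v (r * real (Max (graph_dist G v ` verts G))))) = \<infinity>)"

end

theory Submission
  imports Defs
begin

text \<open>Let \<open>x\<close> be a positive eigenvector of \<open>\<Psi>\<close> for \<open>\<rho>\<close> (Brouwer's theorem yields one), and give an
  edge of colour \<open>j\<close> the resistance \<open>x\<^sub>j\<close>. Passing from \<open>\<Xi>\<^sup>n\<close> to \<open>\<Xi>\<^sup>n\<^sup>+\<^sup>1\<close> then divides the least energy of an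
  extension of a given function by \<open>\<rho>\<close>. Distances obey a similar renormalisation, and distance
  positivity makes the lengths of the copies of edges of different colours comparable and at least
  doubles them at each level.

  If \<open>\<rho> \<le> 1\<close>, the resistance between the endpoints of the initial edge stays bounded, while they
  are a fixed fraction of the diameter apart. If \<open>\<rho> > 1\<close>, choose \<open>k\<close> so large that the copies of the
  edges of \<open>\<Xi>\<^sup>k\<close> at \<open>v\<close> stay inside the ball; extending the indicator of \<open>v\<close> on \<open>\<Xi>\<^sup>k\<close> almost
  optimally gives admissible functions whose energies decay geometrically.\<close>

section \<open>Walks and distances in the underlying undirected graph\<close>

lemma wf_digraph_undir: "wf_digraph G \<Longrightarrow> wf_digraph (undir G)"
  using wf_digraph.wellformed_mk_symmetric wf_digraph_wp_iff by blast

lemma arcs_undir: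
  "arcs (undir G) = (\<Union>e\<in>arcs G. {(tail G e, head G e), (head G e, tail G e)})"
  by (simp add: parcs_mk_symmetric)

text \<open>Increments telescope along the walk. The value type is left open because integer
  potentials serve for path lengths and real ones for energies.\<close>

lemma awalk_potential_diff:
  fixes f :: "'v \<Rightarrow> 'a::linordered_idom"
  assumes G: "wf_digraph G"
    and "pre_digraph.awalk (undir G) u p v"
    and lip: "\<And>e. e \<in> arcs G \<Longrightarrow> \<bar>f (tail G e) - f (head G e)\<bar> \<le> c"
  shows "\<bar>f u - f v\<bar> \<le> of_nat (length p) * c"
  using assms(2)
proof (induction p arbitrary: u)
  interpret U: wf_digraph "undir G" using wf_digraph_undir[OF G] .
  case Nil
  then show ?case by (simp add: U.awalk_Nil_iff)
next
  interpret U: wf_digraph "undir G" using wf_digraph_undir[OF G] .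
  case (Cons a p)
  from Cons.prems have a: "a \<in> arcs (undir G)" "fst a = u" "U.awalk (snd a) p v"
    unfolding U.awalk_Cons_iff by simp_all
  have "\<bar>f (fst a) - f (snd a)\<bar> \<le> c"
    using a(1) lip unfolding arcs_undir by (auto simp: abs_minus_commute)
  moreover have "\<bar>f (snd a) - f v\<bar> \<le> of_nat (length p) * c"
    using Cons.IH a(3) by blast
  moreover have "\<bar>f u - f v\<bar> \<le> \<bar>f (fst a) - f (snd a)\<bar> + \<bar>f (snd a) - f v\<bar>"
    using a(2) abs_triangle_ineq[of "f (fst a) - f (snd a)" "f (snd a) - f v"] by simp
  ultimately have "\<bar>f u - f v\<bar> \<le> c + of_nat (length p) * c"
    by (meson add_mono order_trans)
  then show ?case by (simp add: distrib_right)
qed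

lemma connected_awalk:
  assumes G: "wf_digraph G" "Digraph_Component.connected G" and "u \<in> verts G" "v \<in> verts G"
  obtains p where "pre_digraph.awalk (undir G) u p v"
proof -
  interpret U: wf_digraph "undir G" using wf_digraph_undir[OF G(1)] .
  have "u \<rightarrow>\<^sup>*\<^bsub>undir G\<^esub> v"
    using assms unfolding connected_def strongly_connected_def by simp
  then show ?thesis using U.reachable_awalk that by blast
qed

lemma graph_dist_le:
  "pre_digraph.awalk (undir G) u p v \<Longrightarrow> graph_dist G u v \<le> length p"
  unfolding graph_dist_def by (rule wellorder_Inf_le1) blast

lemma graph_dist_attained:
  assumes "pre_digraph.awalk (undir G) u p v"
  obtains q where "pre_digraph.awalk (undir G) u q v" "length q = graph_dist G u v"
proof -
  have "graph_dist G u v \<in> length ` {p. pre_digraph.awalk (undir G) u p v}"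
    unfolding graph_dist_def using assms by (intro wellorder_InfI) blast
  then show ?thesis using that by auto
qed

lemma graph_dist_arc:
  assumes G: "wf_digraph G"
    and p: "\<And>w. w \<in> verts G \<Longrightarrow> \<exists>p. pre_digraph.awalk (undir G) v p w"
    and e: "e \<in> arcs G"
  shows "\<bar>int (graph_dist G v (tail G e)) - int (graph_dist G v (head G e))\<bar> \<le> 1"
proof -
  interpret U: wf_digraph "undir G" using wf_digraph_undir[OF G] .
  have step: "graph_dist G v b \<le> graph_dist G v a + 1" if ab: "(a, b) \<in> arcs (undir G)" for a b
  proof -
    have "a \<in> verts G" using ab U.tail_in_verts by force
    then obtain q where q: "U.awalk v q a" "length q = graph_dist G v a"
      using p graph_dist_attained by metis
    have "U.awalk a [(a, b)] b" using ab U.arc_implies_awalk by force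
    then have "U.awalk v (q @ [(a, b)]) b" using q(1) by (rule U.awalk_appendI[rotated])
    from graph_dist_le[OF this] show ?thesis using q(2) by simp
  qed
  have "(tail G e, head G e) \<in> arcs (undir G)" "(head G e, tail G e) \<in> arcs (undir G)"
    using e unfolding arcs_undir by auto
  from step[OF this(1)] step[OF this(2)] show ?thesis by linarith
qed

lemma graph_dist_self: "wf_digraph G \<Longrightarrow> v \<in> verts G \<Longrightarrow> graph_dist G v v = 0"
  using graph_dist_le[of G v "[]" v] wf_digraph.awalk_Nil_iff[OF wf_digraph_undir, of G v v]
  by simp

text \<open>The easy half of the duality between distances and 1-Lipschitz functions; it yields the
  lower bounds on distances in the iterated graphs.\<close>

lemma abs_diff_le_graph_dist:
  fixes f :: "'v \<Rightarrow> real"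
  assumes "wf_digraph G" "\<exists>p. pre_digraph.awalk (undir G) u p v"
    and "\<And>e. e \<in> arcs G \<Longrightarrow> \<bar>f (tail G e) - f (head G e)\<bar> \<le> 1"
  shows "\<bar>f u - f v\<bar> \<le> real (graph_dist G u v)"
proof -
  obtain p where p: "pre_digraph.awalk (undir G) u p v" "length p = graph_dist G u v"
    using assms(2) graph_dist_attained by metis
  show ?thesis using awalk_potential_diff[OF assms(1) p(1), of f 1] assms(3) p(2) by simp
qed

section \<open>Monotone homogeneous maps of the positive cone\<close>

text \<open>Comparing \<open>y\<close> with \<open>x\<close> coordinatewise squeezes
  \<open>P y\<close> between the multiples \<open>1 / s y\<close> and \<open>t y\<close> of
  \<open>P x\<close>, and both factors tend to 1 as \<open>y\<close> tends to
  \<open>x\<close>.\<close>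

lemma continuous_on_monotone_homogeneous:
  fixes P :: "real^'k \<Rightarrow> real^'k"
  assumes mono: "\<And>x y i. (\<And>j. 0 < x $ j) \<Longrightarrow> (\<And>j. x $ j \<le> y $ j) \<Longrightarrow> P x $ i \<le> P y $ i"
    and hom: "\<And>x t. (\<And>j. 0 < x $ j) \<Longrightarrow> 0 < t \<Longrightarrow> P (t *\<^sub>R x) = t *\<^sub>R P x"
    and C: "\<And>x j. x \<in> C \<Longrightarrow> 0 < x $ j"
  shows "continuous_on C P"
  unfolding continuous_on_def
proof (intro ballI vec_tendstoI)
  fix x i assume x: "x \<in> C"
  \<comment> \<open>A sum in place of a maximum of ratios: still an upper bound for each of them,
    positive, and visibly continuous.\<close>
  define t where "t y = 1 + (\<Sum>j\<in>UNIV. \<bar>y $ j / x $ j - 1\<bar>)" for y :: "real^'k"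
  define s where "s y = 1 + (\<Sum>j\<in>UNIV. \<bar>x $ j / y $ j - 1\<bar>)" for y :: "real^'k"
  have ratio: "a $ j \<le> (1 + (\<Sum>j\<in>UNIV. \<bar>a $ j / b $ j - 1\<bar>)) * b $ j"
    if "0 < b $ j" for a b :: "real^'k" and j
  proof -
    have "\<bar>a $ j / b $ j - 1\<bar> \<le> (\<Sum>j\<in>UNIV. \<bar>a $ j / b $ j - 1\<bar>)"
      by (rule member_le_sum) auto
    then have "a $ j / b $ j \<le> 1 + (\<Sum>j\<in>UNIV. \<bar>a $ j / b $ j - 1\<bar>)" by linarith
    then show ?thesis using that by (simp add: pos_divide_le_eq)
  qed
  have tpos: "0 < t y" and spos: "0 < s y" for y
    unfolding t_def s_def by (intro add_pos_nonneg sum_nonneg; simp)+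
  have up: "P a $ i \<le> c * P b $ i"
    if "a \<in> C" "b \<in> C" "0 < c" "\<And>j. a $ j \<le> c * b $ j" for a b c
  proof -
    have "P a $ i \<le> P (c *\<^sub>R b) $ i" using that C by (intro mono) auto
    then show ?thesis using hom[OF C[OF that(2)] that(3)] by simp
  qed
  show "((\<lambda>y. P y $ i) \<longlongrightarrow> P x $ i) (at x within C)"
  proof (rule tendsto_sandwich)
    have ev: "\<forall>\<^sub>F y in at x within C. y \<in> C"
      by (simp add: eventually_at_filter)
    show "\<forall>\<^sub>F y in at x within C. P x $ i / s y \<le> P y $ i"
      using ev
    proof eventually_elim
      case (elim y)
      have "P x $ i \<le> s y * P y $ i"
        unfolding s_def using elim x C ratio spos[unfolded s_def] by (intro up) auto
      then show ?case using spos by (simp add: pos_divide_le_eq mult.commute)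
    qed
    show "\<forall>\<^sub>F y in at x within C. P y $ i \<le> t y * P x $ i"
      using ev
    proof eventually_elim
      case (elim y)
      then show ?case
        unfolding t_def using x C ratio tpos[unfolded t_def] by (intro up) auto
    qed
    have xj: "x $ j \<noteq> 0" for j using C[OF x] by (metis less_irrefl)
    have lim: "((\<lambda>y. y $ j) \<longlongrightarrow> x $ j) (at x within C)" for j
      by (intro tendsto_intros)
    have "((\<lambda>y. P x $ i / s y) \<longlongrightarrow> P x $ i / (1 + (\<Sum>j\<in>UNIV. \<bar>x $ j / x $ j - 1\<bar>))) (at x within C)"
      unfolding s_def using xj by (intro tendsto_intros lim) auto
    then show "((\<lambda>y. P x $ i / s y) \<longlongrightarrow> P x $ i) (at x within C)" using xj by simp
    have "((\<lambda>y. t y * P x $ i) \<longlongrightarrow> (1 + (\<Sum>j\<in>UNIV. \<bar>x $ j / x $ j - 1\<bar>)) * P x $ i) (at x within C)"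
      unfolding t_def using xj by (intro tendsto_intros lim) auto
    then show "((\<lambda>y. t y * P x $ i) \<longlongrightarrow> P x $ i) (at x within C)" using xj by simp
  qed
qed

text \<open>Brouwer's theorem for \<open>P\<close> normalised to coordinate sum 1. The uniform ratio
  bound \<open>B\<close> keeps the image away from the boundary of the cone.\<close>

lemma positive_eigenvector_exists:
  fixes P :: "real^'k \<Rightarrow> real^'k"
  assumes mono: "\<And>x y i. (\<And>j. 0 < x $ j) \<Longrightarrow> (\<And>j. x $ j \<le> y $ j) \<Longrightarrow> P x $ i \<le> P y $ i"
    and hom: "\<And>x t. (\<And>j. 0 < x $ j) \<Longrightarrow> 0 < t \<Longrightarrow> P (t *\<^sub>R x) = t *\<^sub>R P x"
    and pos: "\<And>x i. (\<And>j. 0 < x $ j) \<Longrightarrow> 0 < P x $ i"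
    and ratio: "\<And>x i j. (\<And>j. 0 < x $ j) \<Longrightarrow> P x $ i \<le> B * P x $ j"
  obtains \<rho> x where "0 < \<rho>" "\<And>i. 0 < x $ i" "P x = \<rho> *\<^sub>R x"
proof -
  define K where "K = real CARD('k)"
  have K: "0 < K" unfolding K_def by simp
  have B1: "1 \<le> B"
  proof -
    have p: "0 < P 1 $ i" for i by (rule pos) simp
    have "1 * P 1 $ undefined \<le> B * P 1 $ undefined" using ratio[of 1] by simp
    then show ?thesis using p by simp
  qed
  \<comment> \<open>The ratio condition is linear, so \<open>C\<close> is closed and convex, and it
    forces each coordinate to be at least \<open>1 / (K * B)\<close>.\<close>
  define C where "C = {x :: real^'k. (\<forall>i. 0 \<le> x $ i) \<and> (\<Sum>i\<in>UNIV. x $ i) = 1 \<and> (\<forall>i j. x $ i \<le> B * x $ j)}"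
  have Cpos: "0 < x $ j" if "x \<in> C" for x j
  proof -
    have "(\<Sum>i\<in>UNIV. x $ i) \<le> (\<Sum>i\<in>(UNIV::'k set). B * x $ j)"
      using that unfolding C_def by (intro sum_mono) auto
    then have "1 \<le> K * (B * x $ j)" using that unfolding C_def K_def by simp
    then have "x $ j \<noteq> 0" by auto
    then show ?thesis using that unfolding C_def by (simp add: less_le)
  qed
  have "bounded C"
  proof (rule boundedI)
    fix x assume "x \<in> C"
    then show "norm x \<le> 1" using norm_le_l1_cart[of x] unfolding C_def by auto
  qed
  moreover have "closed C"
    unfolding C_def by (intro closed_Collect_conj closed_Collect_all closed_Collect_le
        closed_Collect_eq continuous_intros)
  ultimately have "compact C" by (simp add: compact_eq_bounded_closed)
  moreover have "convex C"
  proof (rule convexI)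
    fix x y :: "real^'k" and u v :: real
    assume xy: "x \<in> C" "y \<in> C" and uv: "0 \<le> u" "0 \<le> v" "u + v = 1"
    have "(\<Sum>i\<in>UNIV. u * x $ i + v * y $ i) = u * (\<Sum>i\<in>UNIV. x $ i) + v * (\<Sum>i\<in>UNIV. y $ i)"
      by (simp add: sum.distrib sum_distrib_left)
    moreover have "u * x $ i + v * y $ i \<le> B * (u * x $ j + v * y $ j)" for i j
    proof -
      have "u * x $ i \<le> u * (B * x $ j)" "v * y $ i \<le> v * (B * y $ j)"
        using xy uv unfolding C_def by (auto intro: mult_left_mono)
      then show ?thesis by (simp add: algebra_simps)
    qed
    ultimately show "u *\<^sub>R x + v *\<^sub>R y \<in> C" using xy uv unfolding C_def by auto
  qed
  moreover have "C \<noteq> {}"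
  proof -
    have "(\<chi> i. 1 / K) \<in> C" using B1 K unfolding C_def by (auto simp: K_def divide_right_mono)
    then show ?thesis by blast
  qed
  moreover define F where "F x = (1 / (\<Sum>i\<in>UNIV. P x $ i)) *\<^sub>R P x" for x
  have sumpos: "0 < (\<Sum>i\<in>UNIV. P x $ i)" if "x \<in> C" for x
    using that Cpos pos by (intro sum_pos) auto
  have "continuous_on C P"
    by (rule continuous_on_monotone_homogeneous) (use mono hom Cpos in auto)
  then have "continuous_on C F"
    unfolding F_def using sumpos by (intro continuous_intros) (auto simp: less_le)
  moreover have "F \<in> C \<rightarrow> C"
  proof
    fix x assume x: "x \<in> C"
    have s: "0 < (\<Sum>i\<in>UNIV. P x $ i)" using sumpos x .
    have "(\<Sum>i\<in>UNIV. F x $ i) = 1"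
      using s unfolding F_def by (simp flip: sum_divide_distrib)
    moreover have "0 \<le> F x $ i" for i
      using s pos[of x i] Cpos[OF x] unfolding F_def by (simp add: less_imp_le)
    moreover have "F x $ i \<le> B * F x $ j" for i j
      using s ratio[of x i j] Cpos[OF x] unfolding F_def by (simp add: divide_right_mono)
    ultimately show "F x \<in> C" unfolding C_def by simp
  qed
  ultimately obtain x where x: "x \<in> C" "F x = x" using brouwer by metis
  have "P x = (\<Sum>i\<in>UNIV. P x $ i) *\<^sub>R F x" using sumpos[OF x(1)] unfolding F_def by simp
  then show ?thesis using that sumpos[OF x(1)] Cpos[OF x(1)] x(2) by metis
qed

text \<open>Let \<open>t\<close> be the least factor with \<open>x \<le> t y\<close> coordinatewise.
  Applying \<open>P\<close> and reading off a coordinate where equality holds gives the claim;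
  exchanging \<open>x\<close> and \<open>y\<close> shows that the eigenvalue is unique.\<close>

lemma positive_eigenvalue_le:
  fixes P :: "real^'k \<Rightarrow> real^'k"
  assumes mono: "\<And>x y i. (\<And>j. 0 < x $ j) \<Longrightarrow> (\<And>j. x $ j \<le> y $ j) \<Longrightarrow> P x $ i \<le> P y $ i"
    and hom: "\<And>x t. (\<And>j. 0 < x $ j) \<Longrightarrow> 0 < t \<Longrightarrow> P (t *\<^sub>R x) = t *\<^sub>R P x"
    and x: "\<And>i. 0 < x $ i" "P x = \<rho> *\<^sub>R x"
    and y: "\<And>i. 0 < y $ i" "P y = \<sigma> *\<^sub>R y"
  shows "\<rho> \<le> \<sigma>"
proof -
  define t where "t = Max (range (\<lambda>i. x $ i / y $ i))"
  have "t \<in> range (\<lambda>i. x $ i / y $ i)" unfolding t_def by (rule Max_in) auto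
  then obtain i where i: "t = x $ i / y $ i" by blast
  have "x $ j \<le> t * y $ j" for j
  proof -
    have "x $ j / y $ j \<le> t" unfolding t_def by (rule Max_ge) auto
    then show ?thesis using y(1) by (simp add: pos_divide_le_eq)
  qed
  then have "P x $ i \<le> P (t *\<^sub>R y) $ i" using x(1) by (intro mono) auto
  moreover have "0 < t" using i x(1) y(1) by simp
  ultimately have "\<rho> * x $ i \<le> t * (\<sigma> * y $ i)" using hom x y by simp
  also have "\<dots> = \<sigma> * x $ i" using i y(1)[of i] by simp
  finally show ?thesis using x(1)[of i] by simp
qed

section \<open>Energies\<close>

lemma energy_nonneg: "(\<And>e. e \<in> arcs G \<Longrightarrow> 0 \<le> r e) \<Longrightarrow> 0 \<le> energy G r f"
  unfolding energy_def by (intro sum_nonneg) auto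

text \<open>Serves to normalise end values to 1 and 0, and conversely to fit a rule potential to
  prescribed end values.\<close>

lemma energy_affine: "energy G r (\<lambda>y. a + c * f y) = c\<^sup>2 * energy G r f"
proof -
  have "(a + c * p - (a + c * q))\<^sup>2 / s = c\<^sup>2 * ((p - q)\<^sup>2 / s)" for p q s :: real
    by (simp add: power2_eq_square algebra_simps)
  then show ?thesis unfolding energy_def by (simp only: sum_distrib_left)
qed

lemma energy_antimono:
  assumes "\<And>e. e \<in> arcs G \<Longrightarrow> 0 < r e" "\<And>e. e \<in> arcs G \<Longrightarrow> r e \<le> r' e"
  shows "energy G r' f \<le> energy G r f"
  unfolding energy_def
proof (intro sum_mono divide_left_mono mult_pos_pos)
  fix e assume e: "e \<in> arcs G"
  show "0 < r e" "r e \<le> r' e" using assms e by auto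
  then show "0 < r' e" by linarith
qed simp

lemma energy_scale: "energy G (\<lambda>e. t * r e) f = energy G r f / t"
  unfolding energy_def by (simp add: sum_divide_distrib mult.commute)

section \<open>Rule graphs\<close>

locale distance_positive_eigs =
  fixes S :: "('v, 'e, 'k::finite) eigs_data"
  assumes eigs: "eigs S" and dpos: "distance_positive S"
begin

abbreviation "R \<equiv> rule S"
abbreviation "bp \<equiv> bplus S"
abbreviation "bm \<equiv> bminus S"
abbreviation "col \<equiv> colour S"

lemma fin_rule: "fin_digraph (R i)"
  and wf_rule: "wf_digraph (R i)"
  and simple_rule: "simple_undir (R i)"
  and connected_rule: "Digraph_Component.connected (R i)"
  and bp_in: "bp i \<in> verts (R i)" and bm_in: "bm i \<in> verts (R i)" and bp_neq_bm: "bp i \<noteq> bm i"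
  using eigs unfolding eigs_def by (auto simp: fin_digraph_def)

lemma finite_rule_arcs: "finite (arcs (R i))" and finite_rule_verts: "finite (verts (R i))"
  using fin_digraph.finite_arcs[OF fin_rule] fin_digraph.finite_verts[OF fin_rule] by auto

lemma rule_apath_exists: "\<exists>p. pre_digraph.apath (undir (R i)) (bp i) p (bm i)"
proof -
  interpret U: wf_digraph "undir (R i)" using wf_digraph_undir[OF wf_rule] .
  obtain p where "U.awalk (bp i) p (bm i)"
    using connected_awalk[OF wf_rule connected_rule bp_in bm_in] .
  then show ?thesis using U.apath_awalk_to_apath by blast
qed

text \<open>\<open>path_matrices\<close> chooses paths in all rule graphs at once, so
  \<open>q\<close> is completed by arbitrary simple paths in the others before positivity of the
  entry at \<open>i\<close>, \<open>j\<close> is used.\<close>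

lemma rule_apath_colour:
  assumes q: "pre_digraph.apath (undir (R i)) (bp i) q (bm i)"
  shows "\<exists>e\<in>arcs_on (R i) q. col i e = j"
proof -
  obtain p0 where p0: "\<And>i. pre_digraph.apath (undir (R i)) (bp i) (p0 i) (bm i)"
    using rule_apath_exists by metis
  define p where "p = p0(i := q)"
  define M :: "nat^'k^'k" where "M = (\<chi> i j. card {e \<in> arcs_on (R i) (p i). col i e = j})"
  have "M \<in> path_matrices S"
    unfolding path_matrices_def M_def using p0 q by (auto simp: p_def)
  then have "0 < M $ i $ j" using dpos unfolding distance_positive_def by blast
  then have "{e \<in> arcs_on (R i) q. col i e = j} \<noteq> {}"
    unfolding M_def p_def by (auto simp: card_gt_0_iff)
  then show ?thesis by blast
qed

text \<open>Since every path between the planting vertices uses colour \<open>j\<close>, those reachable from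
  \<open>\<beta>\<^sub>i\<^sup>+\<close> without colour \<open>j\<close> form such a set.\<close>

lemma colour_cut:
  obtains A where "bp i \<in> A" "bm i \<notin> A"
    "\<And>e. e \<in> arcs (R i) \<Longrightarrow> (tail (R i) e \<in> A) \<noteq> (head (R i) e \<in> A) \<Longrightarrow> col i e = j"
proof -
  interpret U: wf_digraph "undir (R i)" using wf_digraph_undir[OF wf_rule] .
  define Q where "Q = (\<Union>e\<in>{e \<in> arcs (R i). col i e \<noteq> j}.
    {(tail (R i) e, head (R i) e), (head (R i) e, tail (R i) e)})"
  have Qarcs: "Q \<subseteq> arcs (undir (R i))" unfolding Q_def arcs_undir by auto
  define A where "A = {y. (bp i, y) \<in> Q\<^sup>*}"
  have walk: "\<exists>p. U.awalk (bp i) p y \<and> set p \<subseteq> Q" if "(bp i, y) \<in> Q\<^sup>*" for y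
    using that
  proof (induction rule: rtrancl_induct)
    case base
    then show ?case using bp_in by (intro exI[of _ "[]"]) (simp add: U.awalk_Nil_iff)
  next
    case (step y z)
    then obtain p where p: "U.awalk (bp i) p y" "set p \<subseteq> Q" by blast
    have "U.awalk y [(y, z)] z" using step.hyps(2) Qarcs U.arc_implies_awalk by force
    then have "U.awalk (bp i) (p @ [(y, z)]) z" using p(1) by (rule U.awalk_appendI[rotated])
    then show ?case using p(2) step.hyps(2) by (intro exI[of _ "p @ [(y, z)]"]) auto
  qed
  have "bm i \<notin> A"
  proof
    assume "bm i \<in> A"
    then obtain p where p: "U.awalk (bp i) p (bm i)" "set p \<subseteq> Q" using walk A_def by blast
    \<comment> \<open>Distance positivity speaks of simple paths only, so the walk is shortened; its
      arcs stay in \<open>Q\<close>.\<close>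
    define q where "q = U.awalk_to_apath p"
    have "U.apath (bp i) q (bm i)" "set q \<subseteq> Q"
      using U.apath_awalk_to_apath[OF p(1)] U.awalk_to_apath_subset[OF p(1)] p(2) q_def by auto
    then obtain e where e: "e \<in> arcs_on (R i) q" "col i e = j"
      using rule_apath_colour by blast
    then have "e \<in> arcs (R i)" and "(tail (R i) e, head (R i) e) \<in> Q \<or> (head (R i) e, tail (R i) e) \<in> Q"
      using \<open>set q \<subseteq> Q\<close> unfolding arcs_on_def by auto
    then obtain e' where e': "e' \<in> arcs (R i)" "col i e' \<noteq> j"
      "{tail (R i) e, head (R i) e} = {tail (R i) e', head (R i) e'}"
      unfolding Q_def by (auto simp: insert_commute)
    \<comment> \<open>\<open>arcs_on\<close> sees only end points, so simplicity of the rule graph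
      is what excludes a parallel arc of another colour.\<close>
    have "e = e'"
      using simple_rule[of i] e'(1,3) \<open>e \<in> arcs (R i)\<close> unfolding simple_undir_def inj_on_def by blast
    then show False using e(2) e'(2) by simp
  qed
  moreover have "col i e = j"
    if "e \<in> arcs (R i)" "(tail (R i) e \<in> A) \<noteq> (head (R i) e \<in> A)" for e
  proof (rule ccontr)
    assume "col i e \<noteq> j"
    then have "(tail (R i) e, head (R i) e) \<in> Q" "(head (R i) e, tail (R i) e) \<in> Q"
      unfolding Q_def using that(1) by auto
    then show False using that(2) unfolding A_def by (auto intro: rtrancl_into_rtrancl)
  qed
  ultimately show ?thesis using that[of A] unfolding A_def by blast
qed

text \<open>Such an arc would cross the colour cut of every \<open>j\<close>, hence have every
  colour; then there is only one colour, and the distance is assumed to be at least 2.\<close>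

lemma no_planting_arc:
  assumes "e \<in> arcs (R i)"
  shows "{tail (R i) e, head (R i) e} \<noteq> {bp i, bm i}"
proof
  assume ends: "{tail (R i) e, head (R i) e} = {bp i, bm i}"
  have all: "col i e = j" for j
  proof -
    obtain A where "bp i \<in> A" "bm i \<notin> A"
      "\<And>e. e \<in> arcs (R i) \<Longrightarrow> (tail (R i) e \<in> A) \<noteq> (head (R i) e \<in> A) \<Longrightarrow> col i e = j"
      using colour_cut[of i j] by blast
    then show ?thesis using assms ends by (metis doubleton_eq_iff)
  qed
  then have "(UNIV :: 'k set) = {col i e}" by (metis UNIV_eq_I singletonI)
  then have "CARD('k) = card {col i e}" by (rule arg_cong)
  then have "CARD('k) = 1" by simp
  then have "2 \<le> graph_dist (R i) (bp i) (bm i)" using dpos unfolding distance_positive_def by blast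
  moreover have "graph_dist (R i) (bp i) (bm i) \<le> 1"
  proof -
    interpret U: wf_digraph "undir (R i)" using wf_digraph_undir[OF wf_rule] .
    have "(bp i, bm i) \<in> arcs (undir (R i))"
      using assms ends unfolding arcs_undir doubleton_eq_iff by force
    then have "U.awalk (bp i) [(bp i, bm i)] (bm i)" using U.arc_implies_awalk by force
    from graph_dist_le[OF this] show ?thesis by simp
  qed
  ultimately show False by simp
qed

lemma rule_diameter:
  obtains L :: nat where "0 < L" "\<And>i u v. u \<in> verts (R i) \<Longrightarrow> v \<in> verts (R i) \<Longrightarrow>
    \<exists>p. pre_digraph.awalk (undir (R i)) u p v \<and> length p \<le> L"
proof -
  define P where "P i u v = (SOME p. pre_digraph.awalk (undir (R i)) u p v)" for i u v
  have P: "pre_digraph.awalk (undir (R i)) u (P i u v) v"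
    if "u \<in> verts (R i)" "v \<in> verts (R i)" for i u v
    unfolding P_def by (rule connected_awalk[OF wf_rule connected_rule that]) (rule someI)
  define X where "X = (\<Union>i. (\<lambda>(u, v). length (P i u v)) ` (verts (R i) \<times> verts (R i)))"
  have "finite X" unfolding X_def using finite_rule_verts by auto
  then have le: "length (P i u v) \<le> Suc (Max X)" if "u \<in> verts (R i)" "v \<in> verts (R i)" for i u v
    using that by (intro le_SucI Max_ge) (auto simp: X_def)
  show ?thesis using that[of "Suc (Max X)"] P le by blast
qed

section \<open>The resistance map\<close>

abbreviation rule_energy :: "'k \<Rightarrow> real^'k \<Rightarrow> ('v \<Rightarrow> real) \<Rightarrow> real" where
  "rule_energy i x \<equiv> energy (R i) (\<lambda>e. x $ col i e)"

abbreviation unit_potentials :: "'k \<Rightarrow> ('v \<Rightarrow> real) set" where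
  "unit_potentials i \<equiv> {h. h (bp i) = 1 \<and> h (bm i) = 0}"

text \<open>Real-valued reciprocal of the effective resistance in \<open>R i\<close>, so that most
  estimates avoid extended reals.\<close>

definition conductance :: "'k \<Rightarrow> real^'k \<Rightarrow> real" where
  "conductance i x = (INF h\<in>unit_potentials i. rule_energy i x h)"

lemma unit_potentials_nonempty: "unit_potentials i \<noteq> {}"
  using bp_neq_bm[of i] by (auto intro!: exI[of _ "\<lambda>y. if y = bp i then 1 else 0"])

lemma rule_energy_nonneg: "(\<And>j. 0 < x $ j) \<Longrightarrow> 0 \<le> rule_energy i x h"
  by (intro energy_nonneg) (simp add: less_imp_le)

lemma bdd_below_rule_energy: "(\<And>j. 0 < x $ j) \<Longrightarrow> bdd_below (rule_energy i x ` A)"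
  by (intro bdd_belowI[of _ 0]) (auto intro: rule_energy_nonneg)

lemma conductance_le:
  "(\<And>j. 0 < x $ j) \<Longrightarrow> h (bp i) = 1 \<Longrightarrow> h (bm i) = 0 \<Longrightarrow> conductance i x \<le> rule_energy i x h"
  unfolding conductance_def by (intro cINF_lower bdd_below_rule_energy) auto

lemma conductance_ge:
  "(\<And>h. h (bp i) = 1 \<Longrightarrow> h (bm i) = 0 \<Longrightarrow> c \<le> rule_energy i x h) \<Longrightarrow> c \<le> conductance i x"
  unfolding conductance_def by (intro cINF_greatest unit_potentials_nonempty) auto

lemma conductance_approx:
  assumes "\<And>j. 0 < x $ j" "conductance i x < c"
  obtains h where "h (bp i) = 1" "h (bm i) = 0" "rule_energy i x h < c"
  using assms(2) cINF_less_iff[OF unit_potentials_nonempty bdd_below_rule_energy[OF assms(1)]]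
  unfolding conductance_def by blast

text \<open>Affine normalisation of \<open>h\<close> to the end values 1 and 0. This is the lower
  energy bound for one copy of a rule graph.\<close>

lemma rule_energy_ge_conductance:
  assumes x: "\<And>j. 0 < x $ j"
  shows "conductance i x * (h (bp i) - h (bm i))\<^sup>2 \<le> rule_energy i x h"
proof (cases "h (bp i) = h (bm i)")
  case True
  then show ?thesis using rule_energy_nonneg[OF x] by simp
next
  case False
  define d where "d = h (bp i) - h (bm i)"
  have d: "d \<noteq> 0" using False d_def by simp
  define k where "k = (\<lambda>y. (- h (bm i) / d) + (1 / d) * h y)"
  have "conductance i x \<le> rule_energy i x k"
  proof (intro conductance_le x)
    have "k (bp i) = (h (bp i) - h (bm i)) / d"
      unfolding k_def by (simp add: diff_divide_distrib)
    then show "k (bp i) = 1" using d by (simp flip: d_def)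
  qed (simp add: k_def)
  also have "\<dots> = rule_energy i x h / d\<^sup>2"
    unfolding k_def energy_affine by (simp add: power_divide)
  finally show ?thesis using d by (simp add: pos_le_divide_eq flip: d_def)
qed

text \<open>A potential of energy \<open>E\<close> changes by at most \<open>sqrt (E * b)\<close>
  along an arc, yet must drop by 1 along a walk of bounded length. Hence the square of that length
  bound appears as the constant.\<close>

lemma conductance_lower_bound:
  obtains L :: real where "0 < L"
    "\<And>i x b. (\<And>j. 0 < x $ j) \<Longrightarrow> (\<And>j. x $ j \<le> b) \<Longrightarrow> 1 / (L * b) \<le> conductance i x"
proof -
  obtain L where L: "0 < L" "\<And>i u v. u \<in> verts (R i) \<Longrightarrow> v \<in> verts (R i) \<Longrightarrow>
      \<exists>p. pre_digraph.awalk (undir (R i)) u p v \<and> length p \<le> L"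
    using rule_diameter by blast
  have "1 / ((real L)\<^sup>2 * b) \<le> conductance i x"
    if x: "\<And>j. 0 < x $ j" and b: "\<And>j. x $ j \<le> b" for i x b
  proof (rule conductance_ge)
    fix h :: "'v \<Rightarrow> real" assume h: "h (bp i) = 1" "h (bm i) = 0"
    define E where "E = rule_energy i x h"
    have bpos: "0 < b" using x b by (meson less_le_trans)
    have E0: "0 \<le> E" unfolding E_def by (rule rule_energy_nonneg[OF x])
    have step: "\<bar>h (tail (R i) e) - h (head (R i) e)\<bar> \<le> sqrt (E * b)" if e: "e \<in> arcs (R i)" for e
    proof -
      have "(h (tail (R i) e) - h (head (R i) e))\<^sup>2 / x $ col i e \<le> E"
        unfolding E_def energy_def using x e
        by (intro member_le_sum[where f = "\<lambda>e. (h (tail (R i) e) - h (head (R i) e))\<^sup>2 / x $ col i e"])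
           (auto simp: finite_rule_arcs less_imp_le)
      then have "(h (tail (R i) e) - h (head (R i) e))\<^sup>2 \<le> E * x $ col i e"
        using x by (simp add: pos_divide_le_eq)
      also have "\<dots> \<le> E * b" using E0 b by (rule mult_left_mono[rotated])
      finally show ?thesis using real_le_rsqrt by (metis power2_abs)
    qed
    obtain p where p: "pre_digraph.awalk (undir (R i)) (bp i) p (bm i)" "length p \<le> L"
      using L(2) bp_in bm_in by blast
    have "1 \<le> real (length p) * sqrt (E * b)"
      using awalk_potential_diff[OF wf_rule p(1), of h, OF step] h by simp
    also have "\<dots> \<le> real L * sqrt (E * b)"
      using p(2) E0 bpos by (intro mult_right_mono) auto
    finally have "1\<^sup>2 \<le> (real L * sqrt (E * b))\<^sup>2" by (intro power_mono) auto
    then have "1 \<le> E * ((real L)\<^sup>2 * b)" using E0 bpos by (simp add: power_mult_distrib mult_ac)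
    moreover have "0 < (real L)\<^sup>2 * b" using L(1) bpos by simp
    ultimately show "1 / ((real L)\<^sup>2 * b) \<le> rule_energy i x h"
      unfolding E_def[symmetric] by (simp add: pos_divide_le_eq)
  qed
  then show ?thesis using that[of "(real L)\<^sup>2"] L(1) by simp
qed

lemma conductance_pos:
  assumes x: "\<And>j. 0 < x $ j"
  shows "0 < conductance i x"
proof -
  obtain L :: real where L: "0 < L"
    "\<And>i x b. (\<And>j. 0 < x $ j) \<Longrightarrow> (\<And>j. x $ j \<le> b) \<Longrightarrow> 1 / (L * b) \<le> conductance i x"
    using conductance_lower_bound by blast
  define b where "b = Max (range (\<lambda>j. x $ j))"
  have b: "x $ j \<le> b" for j unfolding b_def by (rule Max_ge) auto
  then have "0 < b" using x by (meson less_le_trans)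
  then have "0 < 1 / (L * b)" using L(1) by simp
  also have "\<dots> \<le> conductance i x" using x b by (rule L(2))
  finally show ?thesis .
qed

text \<open>The indicator of a colour cut is the test function: only arcs of colour \<open>j\<close>
  contribute, each \<open>1 / x $ j\<close>. The colour \<open>j\<close> is free, so the largest
  coordinate of \<open>x\<close> may be used.\<close>

lemma conductance_upper_bound:
  obtains N :: real where "0 < N"
    "\<And>i j x. (\<And>j. 0 < x $ j) \<Longrightarrow> conductance i x \<le> N / x $ j"
proof -
  \<comment> \<open>Summing over all rules makes the constant independent of \<open>i\<close>;
    adding 1 makes it positive.\<close>
  define N where "N = real (\<Sum>i\<in>UNIV. card (arcs (R i))) + 1"
  have "conductance i x \<le> N / x $ j" if x: "\<And>j. 0 < x $ j" for i j x
  proof -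
    obtain A where A: "bp i \<in> A" "bm i \<notin> A"
      "\<And>e. e \<in> arcs (R i) \<Longrightarrow> (tail (R i) e \<in> A) \<noteq> (head (R i) e \<in> A) \<Longrightarrow> col i e = j"
      using colour_cut[of i j] by blast
    have "conductance i x \<le> rule_energy i x (\<lambda>y. if y \<in> A then 1 else 0)"
      using A(1,2) by (intro conductance_le x) auto
    also have "\<dots> \<le> (\<Sum>e\<in>arcs (R i). 1 / x $ j)"
      unfolding energy_def
    proof (rule sum_mono)
      fix e assume "e \<in> arcs (R i)"
      then show "((if tail (R i) e \<in> A then 1 else 0) - (if head (R i) e \<in> A then 1 else 0))\<^sup>2
          / x $ col i e \<le> 1 / x $ j"
        using A(3)[of e] x[of j] by (auto simp: less_imp_le)
    qed
    also have "\<dots> = real (card (arcs (R i))) / x $ j" by simp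
    also have "\<dots> \<le> N / x $ j"
    proof (rule divide_right_mono)
      have "card (arcs (R i)) \<le> (\<Sum>i\<in>UNIV. card (arcs (R i)))" by (rule member_le_sum) auto
      then show "real (card (arcs (R i))) \<le> N" unfolding N_def by linarith
    qed (use x in \<open>simp add: less_imp_le\<close>)
    finally show ?thesis .
  qed
  moreover have "0 < N"
    using of_nat_0_le_iff[of "\<Sum>i\<in>UNIV. card (arcs (R i))"] unfolding N_def by linarith
  ultimately show ?thesis using that by blast
qed

lemma conductance_antimono:
  assumes x: "\<And>j. 0 < x $ j" and xy: "\<And>j. x $ j \<le> y $ j"
  shows "conductance i y \<le> conductance i x"
proof (rule conductance_ge)
  fix h :: "'v \<Rightarrow> real" assume h: "h (bp i) = 1" "h (bm i) = 0"
  have "0 < y $ j" for j using x xy by (meson less_le_trans)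
  then have "conductance i y \<le> rule_energy i y h" using h by (intro conductance_le) auto
  also have "\<dots> \<le> rule_energy i x h" using x xy by (intro energy_antimono) auto
  finally show "conductance i y \<le> rule_energy i x h" .
qed

lemma conductance_scale_le:
  assumes x: "\<And>j. 0 < x $ j" and t: "0 < t"
  shows "conductance i (t *\<^sub>R x) \<le> conductance i x / t"
proof -
  have "t * conductance i (t *\<^sub>R x) \<le> conductance i x"
  proof (rule conductance_ge)
    fix h :: "'v \<Rightarrow> real" assume h: "h (bp i) = 1" "h (bm i) = 0"
    have "conductance i (t *\<^sub>R x) \<le> rule_energy i (t *\<^sub>R x) h"
      using h x t by (intro conductance_le) auto
    also have "\<dots> = rule_energy i x h / t" by (simp add: energy_scale)
    finally show "t * conductance i (t *\<^sub>R x) \<le> rule_energy i x h"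
      using t by (simp add: pos_le_divide_eq mult.commute)
  qed
  then show ?thesis using t by (simp add: pos_le_divide_eq mult.commute)
qed

lemma conductance_scale:
  assumes x: "\<And>j. 0 < x $ j" and t: "0 < t"
  shows "conductance i (t *\<^sub>R x) = conductance i x / t"
proof (rule antisym[OF conductance_scale_le[OF assms]])
  have "conductance i ((1 / t) *\<^sub>R (t *\<^sub>R x)) \<le> conductance i (t *\<^sub>R x) / (1 / t)"
    using x t by (intro conductance_scale_le) auto
  then show "conductance i x / t \<le> conductance i (t *\<^sub>R x)"
    using t by (simp add: pos_divide_le_eq)
qed

lemma resistance_map_conv_conductance:
  assumes x: "\<And>j. 0 < x $ j"
  shows "resistance_map S x $ i = 1 / conductance i x"
proof -
  \<comment> \<open>Finiteness lets the extended-real infimum be replaced by the real one.\<close>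
  have *: "\<bar>INF h\<in>unit_potentials i. ereal (rule_energy i x h)\<bar> \<noteq> \<infinity>"
  proof -
    obtain h0 where "h0 \<in> unit_potentials i" using unit_potentials_nonempty by blast
    then have "(INF h\<in>unit_potentials i. ereal (rule_energy i x h)) \<le> ereal (rule_energy i x h0)"
      by (rule INF_lower)
    moreover have "0 \<le> (INF h\<in>unit_potentials i. ereal (rule_energy i x h))"
      using rule_energy_nonneg[OF x] by (intro INF_greatest) simp
    ultimately show ?thesis by auto
  qed
  have "eff_resistance (R i) (\<lambda>e. x $ col i e) {bp i} {bm i} = inverse (ereal (conductance i x))"
    unfolding eff_resistance_def conductance_def ereal_INF[OF *] by simp
  then show ?thesis
    unfolding resistance_map_def using conductance_pos[OF x, of i] by (simp add: divide_inverse)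
qed

lemma resistance_map_mono:
  assumes x: "\<And>j. 0 < x $ j" and xy: "\<And>j. x $ j \<le> y $ j"
  shows "resistance_map S x $ i \<le> resistance_map S y $ i"
proof -
  have y: "0 < y $ j" for j using x xy by (meson less_le_trans)
  show ?thesis
    using conductance_antimono[OF x xy] conductance_pos[OF y]
    by (simp add: resistance_map_conv_conductance x y frac_le)
qed

lemma resistance_map_scale:
  assumes x: "\<And>j. 0 < x $ j" and t: "0 < t"
  shows "resistance_map S (t *\<^sub>R x) = t *\<^sub>R resistance_map S x"
proof -
  have tx: "0 < (t *\<^sub>R x) $ j" for j using x t by simp
  show ?thesis
    unfolding vec_eq_iff resistance_map_conv_conductance[OF tx] conductance_scale[OF assms]
    by (simp add: resistance_map_conv_conductance[OF x])
qed

text \<open>With \<open>b\<close> the largest coordinate of \<open>x\<close>, the two conductance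
  bounds place every resistance between \<open>b / N\<close> and \<open>L * b\<close>. This is the
  ratio bound for Brouwer's theorem; uniqueness then identifies \<open>positive_eigenvalue\<close>.
  The last conclusion is the eigenvalue equation in terms of conductances.\<close>

lemma resistance_eigenvector:
  obtains x where "\<And>j. 0 < x $ j" "0 < positive_eigenvalue (resistance_map S)"
    "\<And>i. conductance i x * (positive_eigenvalue (resistance_map S) * x $ i) = 1"
proof -
  obtain N :: real where N: "0 < N"
    "\<And>i j x. (\<And>j. 0 < x $ j) \<Longrightarrow> conductance i x \<le> N / x $ j"
    using conductance_upper_bound by blast
  obtain L :: real where L: "0 < L"
    "\<And>i x b. (\<And>j. 0 < x $ j) \<Longrightarrow> (\<And>j. x $ j \<le> b) \<Longrightarrow> 1 / (L * b) \<le> conductance i x"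
    using conductance_lower_bound by blast
  have ratio: "resistance_map S x $ i \<le> (N * L) * resistance_map S x $ j"
    if x: "\<And>j. 0 < x $ j" for x i j
  proof -
    define b where "b = Max (range (\<lambda>j. x $ j))"
    have b: "x $ k \<le> b" for k unfolding b_def by (rule Max_ge) auto
    have "b \<in> range (\<lambda>j. x $ j)" unfolding b_def by (rule Max_in) auto
    then obtain k where k: "b = x $ k" by blast
    have "0 < b" using x k by simp
    have "1 / conductance i x \<le> L * b"
      using L(2)[of x b i, OF x b] conductance_pos[OF x, of i] \<open>0 < b\<close> L(1)
      by (simp add: divide_simps mult.commute split: if_splits)
    moreover have "b \<le> N * (1 / conductance j x)"
      using N(2)[of x j k, OF x] conductance_pos[OF x, of j] k \<open>0 < b\<close> by (simp add: field_simps)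
    ultimately have "1 / conductance i x \<le> L * (N * (1 / conductance j x))"
      using L(1) by (meson less_imp_le mult_left_mono order_trans)
    then show ?thesis by (simp add: resistance_map_conv_conductance[OF x] mult_ac)
  qed
  have pos: "0 < resistance_map S x $ i" if x: "\<And>j. 0 < x $ j" for x i
    using conductance_pos[OF x, of i] by (simp add: resistance_map_conv_conductance[OF x])
  obtain \<rho> x where x: "0 < \<rho>" "\<And>i. 0 < x $ i" "resistance_map S x = \<rho> *\<^sub>R x"
    using positive_eigenvector_exists[OF resistance_map_mono resistance_map_scale pos ratio] by metis
  have \<rho>: "positive_eigenvalue (resistance_map S) = \<rho>"
    unfolding positive_eigenvalue_def
  proof (rule the_equality)
    show "0 < \<rho> \<and> (\<exists>x. (\<forall>i. 0 < x $ i) \<and> resistance_map S x = \<rho> *\<^sub>R x)" using x by blast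
  next
    fix \<sigma> assume "0 < \<sigma> \<and> (\<exists>y. (\<forall>i. 0 < y $ i) \<and> resistance_map S y = \<sigma> *\<^sub>R y)"
    then obtain y where y: "\<And>i. 0 < y $ i" "resistance_map S y = \<sigma> *\<^sub>R y" by blast
    show "\<sigma> = \<rho>"
      using positive_eigenvalue_le[OF resistance_map_mono resistance_map_scale x(2,3) y]
        positive_eigenvalue_le[OF resistance_map_mono resistance_map_scale y x(2,3)]
      by fastforce
  qed
  have "conductance i x * (\<rho> * x $ i) = 1" for i
  proof -
    have "\<rho> * x $ i = 1 / conductance i x"
      using x(3) resistance_map_conv_conductance[OF x(2), of i] by simp
    then show ?thesis using conductance_pos[OF x(2), of i] by simp
  qed
  then show ?thesis using that[of x] x(1,2) \<rho> by simp
qed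

section \<open>Growth of distances\<close>

text \<open>A choice of one bound for all rule graphs, to serve as a fixed constant; it need not be
  the exact largest diameter.\<close>

definition diam :: nat where
  "diam = (SOME L. 0 < L \<and> (\<forall>i. \<forall>u\<in>verts (R i). \<forall>v\<in>verts (R i).
     \<exists>p. pre_digraph.awalk (undir (R i)) u p v \<and> length p \<le> L))"

lemma diam: "0 < diam \<and> (\<forall>i. \<forall>u\<in>verts (R i). \<forall>v\<in>verts (R i).
    \<exists>p. pre_digraph.awalk (undir (R i)) u p v \<and> length p \<le> diam)"
  unfolding diam_def by (rule someI_ex) (metis rule_diameter)

lemma rule_potential_diff:
  fixes f :: "'v \<Rightarrow> 'a::linordered_idom"
  assumes "\<And>e. e \<in> arcs (R i) \<Longrightarrow> \<bar>f (tail (R i) e) - f (head (R i) e)\<bar> \<le> c"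
    and "0 \<le> c" "u \<in> verts (R i)" "v \<in> verts (R i)"
  shows "\<bar>f u - f v\<bar> \<le> of_nat diam * c"
proof -
  obtain p where p: "pre_digraph.awalk (undir (R i)) u p v" "length p \<le> diam"
    using diam assms(3,4) by blast
  have "\<bar>f u - f v\<bar> \<le> of_nat (length p) * c"
    using awalk_potential_diff[OF wf_rule p(1)] assms(1) by blast
  also have "\<dots> \<le> of_nat diam * c" using p(2) assms(2) by (intro mult_right_mono) auto
  finally show ?thesis .
qed

definition rule_lip :: "'k \<Rightarrow> ('k \<Rightarrow> nat) \<Rightarrow> ('v \<Rightarrow> int) \<Rightarrow> bool" where
  "rule_lip i x f \<longleftrightarrow> (\<forall>e\<in>arcs (R i). \<bar>f (tail (R i) e) - f (head (R i) e)\<bar> \<le> int (x (col i e)))"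

text \<open>By duality this is the distance between the planting vertices when edges of colour \<open>j\<close> have
  length \<open>x j\<close>. With integer-valued functions the maximum is attained trivially.\<close>

definition crossing :: "('k \<Rightarrow> nat) \<Rightarrow> 'k \<Rightarrow> nat" where
  "crossing x i = Max {k. \<exists>f. rule_lip i x f \<and> f (bm i) - f (bp i) = int k}"

lemma rule_lip_bound:
  assumes f: "rule_lip i x f" and b: "\<And>j. x j \<le> b"
  shows "f (bm i) - f (bp i) \<le> int (diam * b)"
proof -
  have "\<bar>f (bm i) - f (bp i)\<bar> \<le> of_nat diam * int b"
  proof (rule rule_potential_diff)
    fix e assume "e \<in> arcs (R i)"
    then have "\<bar>f (tail (R i) e) - f (head (R i) e)\<bar> \<le> int (x (col i e))"
      using f unfolding rule_lip_def by blast
    also have "\<dots> \<le> int b" using b by simp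
    finally show "\<bar>f (tail (R i) e) - f (head (R i) e)\<bar> \<le> int b" .
  qed (simp_all add: bp_in bm_in)
  then show ?thesis by simp
qed

lemma crossing_set:
  "finite {k. \<exists>f. rule_lip i x f \<and> f (bm i) - f (bp i) = int k}" (is "finite ?A")
  "{k. \<exists>f. rule_lip i x f \<and> f (bm i) - f (bp i) = int k} \<noteq> {}"
proof -
  have "x j \<le> Max (range x)" for j by (rule Max_ge) auto
  then have "int k \<le> int (diam * Max (range x))" if "k \<in> ?A" for k
    using that rule_lip_bound[of i x _ "Max (range x)"] by force
  then have "?A \<subseteq> {.. diam * Max (range x)}" unfolding of_nat_le_iff by blast
  then show "finite ?A" by (rule finite_subset) simp
  have "rule_lip i x (\<lambda>_. 0)" unfolding rule_lip_def by simp
  then show "?A \<noteq> {}" by force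
qed

lemma crossing_attained:
  obtains f where "rule_lip i x f" "f (bm i) - f (bp i) = int (crossing x i)"
  using Max_in[OF crossing_set, of i x] unfolding crossing_def by blast

lemma crossing_ge:
  assumes "rule_lip i x f"
  shows "f (bm i) - f (bp i) \<le> int (crossing x i)"
proof (cases "0 \<le> f (bm i) - f (bp i)")
  case True
  then have "nat (f (bm i) - f (bp i)) \<le> crossing x i"
    unfolding crossing_def using assms by (intro Max_ge crossing_set) auto
  then show ?thesis by simp
qed simp

lemma crossing_ge_abs:
  assumes "rule_lip i x f"
  shows "\<bar>f (bp i) - f (bm i)\<bar> \<le> int (crossing x i)"
proof -
  have "rule_lip i x (\<lambda>y. - f y)" using assms unfolding rule_lip_def by (auto simp: abs_minus_commute)
  from crossing_ge[OF this] crossing_ge[OF assms] show ?thesis by linarith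
qed

lemma crossing_le:
  assumes "\<And>j. x j \<le> b"
  shows "crossing x i \<le> diam * b"
proof -
  obtain f where "rule_lip i x f" "f (bm i) - f (bp i) = int (crossing x i)"
    using crossing_attained .
  then have "int (crossing x i) \<le> int (diam * b)" using rule_lip_bound assms by metis
  then show ?thesis by (simp only: of_nat_le_iff)
qed

text \<open>A step of height \<open>x j\<close> across the colour cut is Lipschitz. Hence every
  length at one level is at most every length at the next.\<close>

lemma crossing_ge_colour: "x j \<le> crossing x i"
proof -
  obtain A where A: "bp i \<in> A" "bm i \<notin> A"
    "\<And>e. e \<in> arcs (R i) \<Longrightarrow> (tail (R i) e \<in> A) \<noteq> (head (R i) e \<in> A) \<Longrightarrow> col i e = j"
    using colour_cut[of i j] by blast
  have "rule_lip i x (\<lambda>y. if y \<in> A then 0 else int (x j))"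
    unfolding rule_lip_def using A(3) by auto
  from crossing_ge[OF this] show ?thesis using A(1,2) by simp
qed

lemma crossing_ge_double:
  assumes m: "\<And>j. m \<le> x j"
  shows "2 * m \<le> crossing x i"
proof -
  \<comment> \<open>No arc joins the two planting vertices, so this function changes by at most
    \<open>m\<close> along every arc.\<close>
  define f where "f y = (if y = bp i then 0 else if y = bm i then 2 * int m else int m)" for y
  have "\<bar>f (tail (R i) e) - f (head (R i) e)\<bar> \<le> int m" if "e \<in> arcs (R i)" for e
    using no_planting_arc[OF that] unfolding f_def by auto
  moreover have "int m \<le> int (x j)" for j using m by simp
  ultimately have "rule_lip i x f" unfolding rule_lip_def by (meson order_trans)
  from crossing_ge[OF this] show ?thesis using bp_neq_bm[of i] unfolding f_def by simp
qed

text \<open>\<open>ell n i\<close> is the distance between the endpoints of the graph grown in \<open>n\<close> steps from an edge of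
  colour \<open>i\<close>; \<open>lo n\<close> is its minimum over the colours.\<close>

primrec ell :: "nat \<Rightarrow> 'k \<Rightarrow> nat" where
  "ell 0 = (\<lambda>_. 1)"
| "ell (Suc n) = crossing (ell n)"

definition lo :: "nat \<Rightarrow> nat" where
  "lo n = Min (range (ell n))"

lemma lo_le: "lo n \<le> ell n i"
  unfolding lo_def by (rule Min_le) auto

lemma lo_attained: obtains i where "lo n = ell n i"
  proof -
  have "Min (range (ell n)) \<in> range (ell n)" by (rule Min_in) auto
  then show ?thesis using that unfolding lo_def by blast
qed

lemma lo_0 [simp]: "lo 0 = 1"
  unfolding lo_def by simp

lemma double_lo: "2 * lo n \<le> lo (Suc n)"
  using lo_attained[of "Suc n"] crossing_ge_double[of "lo n" "ell n", OF lo_le] by fastforce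

lemma lo_pos: "0 < lo n"
proof (induction n)
  case (Suc n)
  then show ?case using double_lo[of n] by simp
qed simp

lemma ell_pos: "0 < ell n i"
  using lo_pos[of n] lo_le[of n i] by simp

text \<open>All lengths at level \<open>m\<close> are at most the least length at level
  \<open>Suc m\<close>, and crossing a rule graph costs at most \<open>diam\<close> times the
  largest of them.\<close>

lemma ell_le: "ell n i \<le> diam * lo n"
proof (cases n)
  case 0
  then show ?thesis using diam by simp
next
  case (Suc m)
  obtain i' where i': "lo n = ell n i'" using lo_attained .
  have "ell m j \<le> lo n" for j using i' Suc by (simp add: crossing_ge_colour)
  then have "crossing (ell m) i \<le> diam * lo n" by (rule crossing_le)
  then show ?thesis using Suc by simp
qed

lemma power_lo: "2 ^ k * lo n \<le> lo (n + k)"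
proof (induction k)
  case (Suc k)
  then show ?case using double_lo[of "n + k"] by simp
qed simp

text \<open>Doubling makes the sum geometric, so displacements summed over all finer levels are
  controlled by a single length.\<close>

lemma sum_lo: "(\<Sum>i<n. lo i) \<le> lo n"
proof (induction n)
  case (Suc n)
  then show ?case using double_lo[of n] by simp
qed simp

section \<open>Lipschitz functions on the iterated graphs\<close>

abbreviation "X \<equiv> Xi S"
abbreviation "ac \<equiv> arc_colour S"
abbreviation "pl n \<equiv> plant S (X n)"

section \<open>Vertices and arcs of the iterated graphs\<close>

lemma plant_bp: "pl n w (bp (ac w)) = tail (X n) w"
  and plant_bm: "pl n w (bm (ac w)) = head (X n) w"
  unfolding plant_def using bp_neq_bm[of "ac w"] by auto

lemma verts_Xi_Suc: "verts (X (Suc n)) = verts (X n) \<union> (\<Union>w\<in>arcs (X n). pl n w ` verts (R (ac w)))"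
  and arcs_Xi_Suc: "arcs (X (Suc n)) = (\<lambda>(w, e). e # w) ` (SIGMA w:arcs (X n). arcs (R (ac w)))"
  and tail_Xi_Suc: "tail (X (Suc n)) (e # w) = pl n w (tail (R (ac w)) e)"
  and head_Xi_Suc: "head (X (Suc n)) (e # w) = pl n w (head (R (ac w)) e)"
  by (auto simp: Let_def)

declare Xi.simps(2) [simp del]

lemma length_Xi_arc: "w \<in> arcs (X n) \<Longrightarrow> length w = n"
  by (induction n arbitrary: w) (auto simp: arcs_Xi_Suc)

lemma fin_Xi: "fin_digraph (X n)"
proof (induction n)
  case 0
  show ?case by unfold_locales auto
next
  case (Suc n)
  interpret fin_digraph "X n" by fact
  show ?case
  proof
    fix u assume "u \<in> arcs (X (Suc n))"
    then obtain w e where u: "u = e # w" "w \<in> arcs (X n)" "e \<in> arcs (R (ac w))"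
      by (auto simp: arcs_Xi_Suc)
    then show "tail (X (Suc n)) u \<in> verts (X (Suc n))" "head (X (Suc n)) u \<in> verts (X (Suc n))"
      using wf_digraph.tail_in_verts[OF wf_rule] wf_digraph.head_in_verts[OF wf_rule]
      unfolding verts_Xi_Suc u(1) tail_Xi_Suc head_Xi_Suc by blast+
  next
    show "finite (verts (X (Suc n)))" "finite (arcs (X (Suc n)))"
      by (auto simp: verts_Xi_Suc arcs_Xi_Suc finite_rule_verts finite_rule_arcs
          intro!: finite_imageI finite_SigmaI)
  qed
qed

lemma wf_Xi: "wf_digraph (X n)"
  using fin_Xi by (simp add: fin_digraph_def)

lemma tail_in_Xi: "w \<in> arcs (X n) \<Longrightarrow> tail (X n) w \<in> verts (X n)"
  and head_in_Xi: "w \<in> arcs (X n) \<Longrightarrow> head (X n) w \<in> verts (X n)"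
  using wf_digraph.tail_in_verts[OF wf_Xi] wf_digraph.head_in_verts[OF wf_Xi] by auto

text \<open>A vertex records the arc, hence the level, at which it was created; an old vertex
  therefore cannot carry an arc of \<open>X n\<close> as its label.\<close>

lemma length_Xi_Inner: "Inner w x \<in> verts (X n) \<Longrightarrow> length w < n"
proof (induction n arbitrary: w x)
  case (Suc n)
  show ?case
  proof (cases "Inner w x \<in> verts (X n)")
    case True
    then show ?thesis using Suc.IH by (simp add: less_SucI)
  next
    case False
    then obtain u y where u: "u \<in> arcs (X n)" "Inner w x = pl n u y"
      using Suc.prems by (auto simp: verts_Xi_Suc)
    then have "w = u"
      using tail_in_Xi[OF u(1)] head_in_Xi[OF u(1)] False
      unfolding plant_def by (auto split: if_splits)
    then show ?thesis using length_Xi_arc[OF u(1)] by simp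
  qed
qed simp

lemma verts_Xi_mono: "m \<le> n \<Longrightarrow> verts (X m) \<subseteq> verts (X n)"
  by (rule lift_Suc_mono_le[of "\<lambda>n. verts (X n)"]) (auto simp: verts_Xi_Suc)

lemma Xi_endpoints: "V_plus \<in> verts (X n)" "V_minus \<in> verts (X n)"
  using verts_Xi_mono[of 0 n] by auto

text \<open>The length of \<open>w\<close> in \<open>Inner w x\<close> separates the new vertices from the old ones.\<close>

lemma Xi_extend:
  fixes g :: "('v, 'e) xvertex \<Rightarrow> 'a"
  assumes "\<And>w. w \<in> arcs (X n) \<Longrightarrow> H w (bp (ac w)) = g (tail (X n) w)"
    and "\<And>w. w \<in> arcs (X n) \<Longrightarrow> H w (bm (ac w)) = g (head (X n) w)"
  obtains g' where "\<And>y. y \<in> verts (X n) \<Longrightarrow> g' y = g y"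
    "\<And>w x. w \<in> arcs (X n) \<Longrightarrow> g' (pl n w x) = H w x"
proof -
  define g' where "g' y = (case y of Inner w x \<Rightarrow> if w \<in> arcs (X n) then H w x else g y | _ \<Rightarrow> g y)" for y
  have old: "g' y = g y" if "y \<in> verts (X n)" for y
    using that length_Xi_Inner[of _ _ n] length_Xi_arc[of _ n] unfolding g'_def
    by (auto split: xvertex.split)
  moreover have "g' (pl n w x) = H w x" if "w \<in> arcs (X n)" for w x
  proof -
    have "g' (Inner w x) = H w x" unfolding g'_def using that by simp
    then show ?thesis
      unfolding plant_def using that assms tail_in_Xi head_in_Xi old by auto
  qed
  ultimately show ?thesis using that by blast
qed

text \<open>One notion for two types: integer functions can be restricted by means of the integer
  maximum \<open>crossing\<close>, real ones can be interpolated with fractional slopes.\<close>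

definition lip :: "nat \<Rightarrow> ('k \<Rightarrow> nat) \<Rightarrow> (('v, 'e) xvertex \<Rightarrow> 'a::linordered_idom) \<Rightarrow> bool" where
  "lip n x f \<longleftrightarrow> (\<forall>w\<in>arcs (X n). \<bar>f (tail (X n) w) - f (head (X n) w)\<bar> \<le> of_nat (x (ac w)))"

lemma lip_Suc:
  "lip (Suc n) x f \<longleftrightarrow> (\<forall>w\<in>arcs (X n). \<forall>e\<in>arcs (R (ac w)).
     \<bar>f (pl n w (tail (R (ac w)) e)) - f (pl n w (head (R (ac w)) e))\<bar> \<le> of_nat (x (col (ac w) e)))"
  unfolding lip_def arcs_Xi_Suc by (auto simp: tail_Xi_Suc head_Xi_Suc)

lemma lip_restrict:
  fixes f :: "('v, 'e) xvertex \<Rightarrow> int"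
  assumes "lip (Suc n) x f"
  shows "lip n (crossing x) f"
  unfolding lip_def
proof
  fix w assume w: "w \<in> arcs (X n)"
  then have "rule_lip (ac w) x (\<lambda>y. f (pl n w y))"
    using assms unfolding lip_Suc rule_lip_def by simp
  from crossing_ge_abs[OF this]
  show "\<bar>f (tail (X n) w) - f (head (X n) w)\<bar> \<le> of_nat (crossing x (ac w))"
    by (simp add: plant_bp plant_bm)
qed

lemma lip_restrict_ell:
  fixes f :: "('v, 'e) xvertex \<Rightarrow> int"
  shows "lip (n + k) (ell j) f \<Longrightarrow> lip n (ell (j + k)) f"
proof (induction k arbitrary: j)
  case (Suc k)
  then have "lip (n + k) (ell (Suc j)) f" using lip_restrict by simp
  from Suc.IH[OF this] show ?case by simp
qed simp

text \<open>Each copy receives a maximiser of \<open>crossing\<close>, shifted and scaled to the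
  prescribed end values; the Lipschitz hypothesis keeps the slope \<open>s w\<close> between -1 and
  1.\<close>

lemma lip_extend:
  fixes f :: "('v, 'e) xvertex \<Rightarrow> real"
  assumes f: "lip n (crossing x) f" and x: "\<And>j. 0 < x j"
  obtains f' :: "('v, 'e) xvertex \<Rightarrow> real"
    where "\<And>y. y \<in> verts (X n) \<Longrightarrow> f' y = f y" "lip (Suc n) x f'"
proof -
  have "\<forall>i. \<exists>h. rule_lip i x h \<and> h (bm i) - h (bp i) = int (crossing x i)"
    using crossing_attained by metis
  then obtain h where h: "\<And>i. rule_lip i x (h i)"
    "\<And>i. h i (bm i) - h i (bp i) = int (crossing x i)"
    by metis
  have cpos: "0 < crossing x i" for i using x crossing_ge_colour[of x] by (meson less_le_trans)
  define s where "s w = (f (head (X n) w) - f (tail (X n) w)) / real (crossing x (ac w))" for w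
  define H where "H w y = f (tail (X n) w) + s w * real_of_int (h (ac w) y - h (ac w) (bp (ac w)))" for w y
  obtain f' where f': "\<And>y. y \<in> verts (X n) \<Longrightarrow> f' y = f y"
    "\<And>w x. w \<in> arcs (X n) \<Longrightarrow> f' (pl n w x) = H w x"
  proof (rule Xi_extend[of n H f])
    fix w
    show "H w (bp (ac w)) = f (tail (X n) w)" unfolding H_def by simp
    show "H w (bm (ac w)) = f (head (X n) w)" unfolding H_def s_def h(2) using cpos[of "ac w"] by simp
  qed blast
  have "lip (Suc n) x f'"
    unfolding lip_Suc
  proof (intro ballI)
    fix w e assume w: "w \<in> arcs (X n)" and e: "e \<in> arcs (R (ac w))"
    let ?d = "h (ac w) (tail (R (ac w)) e) - h (ac w) (head (R (ac w)) e)"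
    have s: "\<bar>s w\<bar> \<le> 1"
      using f w cpos[of "ac w"] unfolding lip_def s_def
      by (auto simp: abs_divide divide_le_eq abs_minus_commute)
    have "\<bar>?d\<bar> \<le> int (x (col (ac w) e))" using h(1) e unfolding rule_lip_def by blast
    then have d: "\<bar>real_of_int ?d\<bar> \<le> real (x (col (ac w) e))" by linarith
    have "f' (pl n w (tail (R (ac w)) e)) - f' (pl n w (head (R (ac w)) e)) = s w * real_of_int ?d"
      unfolding f'(2)[OF w] H_def by (simp add: algebra_simps)
    moreover have "\<bar>s w * real_of_int ?d\<bar> \<le> 1 * real (x (col (ac w) e))"
      unfolding abs_mult using s d by (intro mult_mono) auto
    ultimately show "\<bar>f' (pl n w (tail (R (ac w)) e)) - f' (pl n w (head (R (ac w)) e))\<bar>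
        \<le> real (x (col (ac w) e))" by simp
  qed
  then show ?thesis using that f'(1) by blast
qed

text \<open>The index \<open>k\<close> is kept general because each extension to the next graph
  trades one step of \<open>ell\<close> for one step of \<open>n\<close>.\<close>

lemma lip_separating_endpoints:
  obtains f :: "('v, 'e) xvertex \<Rightarrow> real"
    where "lip n (ell k) f" "f V_plus = 0" "f V_minus = real (ell (n + k) (init_colour S))"
proof (induction n arbitrary: k thesis)
  case 0
  show ?case
    by (rule 0[of "\<lambda>y. if y = V_minus then real (ell k (init_colour S)) else 0"]) (auto simp: lip_def)
next
  case (Suc n)
  obtain f where f: "lip n (ell (Suc k)) f" "f V_plus = 0"
    "f V_minus = real (ell (n + Suc k) (init_colour S))"
    by (rule Suc.IH)
  obtain f' :: "('v, 'e) xvertex \<Rightarrow> real"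
    where f': "\<And>y. y \<in> verts (X n) \<Longrightarrow> f' y = f y" "lip (Suc n) (ell k) f'"
    using lip_extend[of n "ell k" f] f(1) ell_pos by auto
  show ?case
    by (rule Suc.prems[of f']) (use f f' Xi_endpoints in auto)
qed

text \<open>Connectedness stated through functions: values agree within a copy because rule graphs
  are connected, and this reduces the claim to the arcs of the previous graph.\<close>

lemma Xi_constant:
  fixes f :: "('v, 'e) xvertex \<Rightarrow> int"
  assumes "lip n (\<lambda>_. 0) f" "y \<in> verts (X n)"
  shows "f y = f V_plus"
  using assms
proof (induction n arbitrary: y)
  case 0
  then show ?case by (auto simp: lip_def)
next
  case (Suc n)
  have const: "f (pl n w a) = f (pl n w b)"
    if w: "w \<in> arcs (X n)" and ab: "a \<in> verts (R (ac w))" "b \<in> verts (R (ac w))" for w a b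
    using rule_potential_diff[of "ac w" "\<lambda>y. f (pl n w y)" 0 a b] Suc.prems(1) that
    unfolding lip_Suc by auto
  have "lip n (\<lambda>_. 0) f"
    unfolding lip_def using const[OF _ bp_in bm_in] by (simp add: plant_bp plant_bm)
  then have old: "f y = f V_plus" if "y \<in> verts (X n)" for y using Suc.IH that by blast
  show ?case
  proof (cases "y \<in> verts (X n)")
    case False
    then obtain w a where w: "w \<in> arcs (X n)" "a \<in> verts (R (ac w))" "y = pl n w a"
      using Suc.prems(2) by (auto simp: verts_Xi_Suc)
    then have "f y = f (tail (X n) w)" using const[OF w(1,2) bp_in] by (simp add: plant_bp)
    then show ?thesis using old tail_in_Xi w(1) by simp
  qed (rule old)
qed

lemma Xi_connected:
  assumes u: "u \<in> verts (X n)" and v: "v \<in> verts (X n)"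
  shows "\<exists>p. pre_digraph.awalk (undir (X n)) u p v"
proof -
  interpret U: wf_digraph "undir (X n)" using wf_digraph_undir[OF wf_Xi] .
  \<comment> \<open>The indicator of the vertices reachable from \<open>u\<close> has no increment
    along an arc, hence is constant.\<close>
  define f where "f y = (if \<exists>p. U.awalk u p y then 1 else 0 :: int)" for y
  have step: "\<exists>p. U.awalk u p b" if "U.awalk u p a" "(a, b) \<in> arcs (undir (X n))" for a b p
  proof -
    have "U.awalk a [(a, b)] b" using U.arc_implies_awalk that(2) by force
    then show ?thesis using that(1) U.awalk_appendI by blast
  qed
  have "lip n (\<lambda>_. 0) f"
    unfolding lip_def
  proof
    fix w assume "w \<in> arcs (X n)"
    then have "(tail (X n) w, head (X n) w) \<in> arcs (undir (X n))"
      "(head (X n) w, tail (X n) w) \<in> arcs (undir (X n))"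
      unfolding arcs_undir by auto
    then have "(\<exists>p. U.awalk u p (tail (X n) w)) \<longleftrightarrow> (\<exists>p. U.awalk u p (head (X n) w))"
      using step by blast
    then show "\<bar>f (tail (X n) w) - f (head (X n) w)\<bar> \<le> of_nat 0" unfolding f_def by simp
  qed
  then have "f u = f v" using Xi_constant u v by metis
  moreover have "U.awalk u [] u" using u by (simp add: U.awalk_Nil_iff)
  then have "f u = 1" unfolding f_def by auto
  ultimately show ?thesis unfolding f_def by (auto split: if_splits)
qed

section \<open>Distances and eccentricities in the iterated graphs\<close>

lemma lip_graph_dist:
  assumes "v \<in> verts (X n)"
  shows "lip n (ell 0) (\<lambda>y. int (graph_dist (X n) v y))"
  unfolding lip_def using graph_dist_arc[OF wf_Xi] Xi_connected[OF assms] by simp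

lemma graph_dist_endpoints: "lo n \<le> graph_dist (X n) V_plus V_minus"
proof -
  obtain f :: "('v, 'e) xvertex \<Rightarrow> real"
    where f: "lip n (ell 0) f" "f V_plus = 0" "f V_minus = real (ell (n + 0) (init_colour S))"
    using lip_separating_endpoints .
  have "\<bar>f V_plus - f V_minus\<bar> \<le> real (graph_dist (X n) V_plus V_minus)"
    using f(1) Xi_connected[OF Xi_endpoints]
    by (intro abs_diff_le_graph_dist wf_Xi) (auto simp: lip_def)
  then have "ell n (init_colour S) \<le> graph_dist (X n) V_plus V_minus" using f by simp
  then show ?thesis using lo_le order_trans by blast
qed

text \<open>Along an arc of \<open>X (Suc n)\<close> the function changes by at most
  \<open>diam * lo (N - Suc n)\<close>, and at most \<open>diam\<close> arcs join two vertices of a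
  copy; hence the square.\<close>

lemma lip_copy_diff:
  fixes f :: "('v, 'e) xvertex \<Rightarrow> int"
  assumes f: "lip N (ell 0) f" and n: "n < N" and w: "w \<in> arcs (X n)"
    and xy: "x \<in> verts (R (ac w))" "y \<in> verts (R (ac w))"
  shows "\<bar>f (pl n w x) - f (pl n w y)\<bar> \<le> int (diam\<^sup>2 * lo (N - Suc n))"
proof -
  have "lip (Suc n) (ell (N - Suc n)) f"
    using lip_restrict_ell[of "Suc n" "N - Suc n" 0 f] f n by simp
  then have "\<bar>f (pl n w (tail (R (ac w)) e)) - f (pl n w (head (R (ac w)) e))\<bar>
      \<le> int (diam * lo (N - Suc n))" if "e \<in> arcs (R (ac w))" for e
  proof -
    have "\<bar>f (pl n w (tail (R (ac w)) e)) - f (pl n w (head (R (ac w)) e))\<bar>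
        \<le> int (ell (N - Suc n) (col (ac w) e))"
      using \<open>lip (Suc n) (ell (N - Suc n)) f\<close> w that unfolding lip_Suc by simp
    also have "\<dots> \<le> int (diam * lo (N - Suc n))" using ell_le by (simp flip: of_nat_mult)
    finally show ?thesis .
  qed
  then have "\<bar>f (pl n w x) - f (pl n w y)\<bar> \<le> of_nat diam * int (diam * lo (N - Suc n))"
    using xy by (intro rule_potential_diff[of "ac w" "\<lambda>y. f (pl n w y)"]) auto
  then show ?thesis by (simp add: power2_eq_square)
qed

text \<open>The sets \<open>A m\<close> grow only by vertices of copies whose arc has an end in
  them, so each level adds one term from the copy estimate. Stated for general \<open>A\<close>
  since it serves both for all vertices and for \<open>near\<close>.\<close>

lemma lip_spread:
  fixes f :: "('v, 'e) xvertex \<Rightarrow> int"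
  assumes f: "lip N (ell 0) f"
    and base: "\<And>y. y \<in> A 0 \<Longrightarrow> \<bar>f y - f v\<bar> \<le> int b"
    and step: "\<And>m y. y \<in> A (Suc m) \<Longrightarrow> y \<in> A m \<or> (\<exists>w\<in>arcs (X (k + m)). \<exists>x\<in>verts (R (ac w)).
      y = pl (k + m) w x \<and> (tail (X (k + m)) w \<in> A m \<or> head (X (k + m)) w \<in> A m))"
    and "k + m \<le> N" "y \<in> A m"
  shows "\<bar>f y - f v\<bar> \<le> int (b + diam\<^sup>2 * (\<Sum>i\<in>{N - (k + m)..<N - k}. lo i))"
  using assms(4,5)
proof (induction m arbitrary: y)
  case 0
  then show ?case using base by simp
next
  case (Suc m)
  let ?s = "\<lambda>m. int (b + diam\<^sup>2 * (\<Sum>i\<in>{N - (k + m)..<N - k}. lo i))"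
  have eq: "?s (Suc m) = int (diam\<^sup>2 * lo (N - Suc (k + m))) + ?s m"
  proof -
    have "{N - (k + Suc m)..<N - k} = insert (N - Suc (k + m)) {N - (k + m)..<N - k}"
      using Suc.prems(1) by auto
    then show ?thesis using Suc.prems(1) by (simp add: algebra_simps)
  qed
  have IH: "\<bar>f y - f v\<bar> \<le> ?s m" if "y \<in> A m" for y using Suc.IH Suc.prems(1) that by simp
  from step[OF Suc.prems(2)] show ?case
  proof
    assume "y \<in> A m"
    then show ?thesis using IH[of y] unfolding eq by linarith
  next
    assume "\<exists>w\<in>arcs (X (k + m)). \<exists>x\<in>verts (R (ac w)).
      y = pl (k + m) w x \<and> (tail (X (k + m)) w \<in> A m \<or> head (X (k + m)) w \<in> A m)"
    then obtain w x where w: "w \<in> arcs (X (k + m))" "x \<in> verts (R (ac w))" "y = pl (k + m) w x"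
      "tail (X (k + m)) w \<in> A m \<or> head (X (k + m)) w \<in> A m" by blast
    then obtain z where z: "z \<in> verts (R (ac w))" "pl (k + m) w z \<in> A m"
      using bp_in bm_in by (metis plant_bp plant_bm)
    have "\<bar>f y - f (pl (k + m) w z)\<bar> \<le> int (diam\<^sup>2 * lo (N - Suc (k + m)))"
      unfolding w(3) using Suc.prems(1) w z by (intro lip_copy_diff[OF f]) auto
    then show ?thesis using IH[OF z(2)] unfolding eq by linarith
  qed
qed

lemma graph_dist_V_plus_le:
  assumes "y \<in> verts (X n)"
  shows "graph_dist (X n) V_plus y \<le> (diam + diam\<^sup>2) * lo n"
proof -
  define f where "f y = int (graph_dist (X n) V_plus y)" for y
  have f: "lip n (ell 0) f" unfolding f_def by (rule lip_graph_dist[OF Xi_endpoints(1)])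
  have f0: "f V_plus = 0" unfolding f_def using graph_dist_self[OF wf_Xi Xi_endpoints(1)] by simp
  have "lip 0 (ell n) f" using lip_restrict_ell[of 0 n 0 f] f by simp
  then have "\<bar>f z - f V_plus\<bar> \<le> int (ell n (init_colour S))" if "z \<in> verts (X 0)" for z
    using that by (auto simp: lip_def abs_minus_commute)
  then have "\<bar>f y - f V_plus\<bar> \<le> int (ell n (init_colour S) + diam\<^sup>2 * (\<Sum>i\<in>{n - (0 + n)..<n - 0}. lo i))"
    using assms tail_in_Xi
    by (intro lip_spread[OF f, of "\<lambda>m. verts (X m)"]) (auto simp: verts_Xi_Suc)
  then have "graph_dist (X n) V_plus y \<le> ell n (init_colour S) + diam\<^sup>2 * (\<Sum>i<n. lo i)"
    unfolding f0 unfolding f_def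
    by (simp add: atLeast0LessThan flip: of_nat_sum of_nat_mult of_nat_add of_nat_power)
  also have "\<dots> \<le> diam * lo n + diam\<^sup>2 * lo n"
    using ell_le sum_lo by (intro add_mono mult_le_mono2) auto
  finally show ?thesis by (simp add: distrib_right)
qed

text \<open>One of the endpoints of the initial edge is at distance at least half of
  \<open>lo n\<close> from \<open>v\<close>. A potential separating the endpoints replaces the
  triangle inequality.\<close>

lemma eccentricity_ge:
  assumes v: "v \<in> verts (X n)"
  shows "lo n \<le> 2 * Max (graph_dist (X n) v ` verts (X n))"
proof -
  let ?M = "Max (graph_dist (X n) v ` verts (X n))"
  have le: "graph_dist (X n) v y \<le> ?M" if "y \<in> verts (X n)" for y
    using that fin_digraph.finite_verts[OF fin_Xi] by (intro Max_ge) auto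
  obtain f :: "('v, 'e) xvertex \<Rightarrow> real"
    where f: "lip n (ell 0) f" "f V_plus = 0" "f V_minus = real (ell (n + 0) (init_colour S))"
    using lip_separating_endpoints .
  have "\<bar>f v - f y\<bar> \<le> real (graph_dist (X n) v y)" if "y \<in> verts (X n)" for y
    using f(1) Xi_connected[OF v that]
    by (intro abs_diff_le_graph_dist wf_Xi) (auto simp: lip_def)
  from this[OF Xi_endpoints(1)] this[OF Xi_endpoints(2)]
  have "ell n (init_colour S) \<le> graph_dist (X n) v V_plus + graph_dist (X n) v V_minus"
    using f(2,3) by simp
  moreover have "lo n \<le> ell n (init_colour S)" by (rule lo_le)
  ultimately show ?thesis using le[OF Xi_endpoints(1)] le[OF Xi_endpoints(2)] by simp
qed

section \<open>Energies on the iterated graphs\<close>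

abbreviation Xi_energy :: "nat \<Rightarrow> real^'k \<Rightarrow> (('v, 'e) xvertex \<Rightarrow> real) \<Rightarrow> real" where
  "Xi_energy n x \<equiv> energy (X n) (\<lambda>w. x $ ac w)"

lemma Xi_energy_Suc:
  "Xi_energy (Suc n) x f = (\<Sum>w\<in>arcs (X n). rule_energy (ac w) x (\<lambda>y. f (pl n w y)))"
proof -
  have inj: "inj_on (\<lambda>(w, e). e # w) (SIGMA w:arcs (X n). arcs (R (ac w)))"
    by (auto simp: inj_on_def)
  show ?thesis
    unfolding energy_def arcs_Xi_Suc sum.reindex[OF inj]
    by (subst sum.Sigma)
      (auto simp: fin_digraph.finite_arcs[OF fin_Xi] finite_rule_arcs tail_Xi_Suc head_Xi_Suc
        intro!: sum.cong)
qed

text \<open>Each copy contributes at least its conductance times the squared increment; as the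
  conductance is \<open>1 / (\<rho> * x $ i)\<close>, one level divides the bound by
  \<open>\<rho>\<close>.\<close>

lemma Xi_energy_ge:
  assumes x: "\<And>j. 0 < x $ j" and \<rho>: "0 < \<rho>" "\<And>i. conductance i x * (\<rho> * x $ i) = 1"
    and f: "f V_plus = 1" "f V_minus = 0"
  shows "1 / (\<rho> ^ n * x $ init_colour S) \<le> Xi_energy n x f"
proof (induction n)
  case 0
  then show ?case using f by (simp add: energy_def)
next
  case (Suc n)
  have c: "conductance i x = 1 / (\<rho> * x $ i)" for i
    using \<rho>(2)[of i] \<rho>(1) x[of i] by (simp add: field_simps)
  have "1 / (\<rho> ^ Suc n * x $ init_colour S) \<le> Xi_energy n x f / \<rho>"
    using Suc \<rho>(1) by (simp add: field_simps)
  also have "\<dots> = (\<Sum>w\<in>arcs (X n). conductance (ac w) x * (f (tail (X n) w) - f (head (X n) w))\<^sup>2)"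
    unfolding energy_def c sum_divide_distrib by (simp add: mult.commute)
  also have "\<dots> \<le> Xi_energy (Suc n) x f"
    unfolding Xi_energy_Suc
  proof (rule sum_mono)
    fix w
    show "conductance (ac w) x * (f (tail (X n) w) - f (head (X n) w))\<^sup>2
        \<le> rule_energy (ac w) x (\<lambda>y. f (pl n w y))"
      using rule_energy_ge_conductance[OF x, of "ac w" "\<lambda>y. f (pl n w y)"]
      by (simp add: plant_bp plant_bm)
  qed
  finally show ?case .
qed

text \<open>\<open>near k v m\<close> contains the support of every function on \<open>\<Xi>\<^sup>k\<^sup>+\<^sup>m\<close> obtained from the indicator of
  \<open>v\<close> on \<open>\<Xi>\<^sup>k\<close> by extensions that vanish on the copies of edges with both end values \<open>0\<close>.\<close>

primrec near :: "nat \<Rightarrow> ('v, 'e) xvertex \<Rightarrow> nat \<Rightarrow> ('v, 'e) xvertex set" where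
  "near k v 0 = {v}"
| "near k v (Suc m) = near k v m \<union> {pl (k + m) w x | w x. w \<in> arcs (X (k + m)) \<and>
     x \<in> verts (R (ac w)) \<and> (tail (X (k + m)) w \<in> near k v m \<or> head (X (k + m)) w \<in> near k v m)}"

text \<open>Growth starts from the single vertex \<open>v\<close>, so only copies made from level
  \<open>k\<close> on count. By \<open>power_lo\<close> the bound is a fraction of
  \<open>lo n\<close> that shrinks with \<open>k\<close>.\<close>

lemma graph_dist_near:
  assumes v: "v \<in> verts (X n)" and "k \<le> n" "y \<in> near k v (n - k)"
  shows "graph_dist (X n) v y \<le> diam\<^sup>2 * lo (n - k)"
proof -
  define f where "f y = int (graph_dist (X n) v y)" for y
  have f: "lip n (ell 0) f" unfolding f_def by (rule lip_graph_dist[OF v])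
  have f0: "f v = 0" unfolding f_def using graph_dist_self[OF wf_Xi v] by simp
  have "\<bar>f y - f v\<bar> \<le> int (0 + diam\<^sup>2 * (\<Sum>i\<in>{n - (k + (n - k))..<n - k}. lo i))"
    using assms(2,3) by (intro lip_spread[OF f, of "near k v"]) auto
  then have "int (graph_dist (X n) v y) \<le> int (diam\<^sup>2 * (\<Sum>i<n - k. lo i))"
    unfolding f0 unfolding f_def using assms(2) by (simp add: atLeast0LessThan)
  then have "graph_dist (X n) v y \<le> diam\<^sup>2 * (\<Sum>i<n - k. lo i)" by (simp only: of_nat_le_iff)
  also have "\<dots> \<le> diam\<^sup>2 * lo (n - k)" using sum_lo by (rule mult_le_mono2)
  finally show ?thesis .
qed

text \<open>The infimum defining \<open>conductance\<close> is only approximated, so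
  \<open>\<rho>\<close> is replaced by a smaller \<open>\<sigma>\<close>. Interpolating affinely
  between the end values makes a copy with both end values 0 vanish.\<close>

lemma Xi_energy_extend:
  assumes x: "\<And>j. 0 < x $ j" and \<rho>: "\<And>i. conductance i x * (\<rho> * x $ i) = 1"
    and \<sigma>: "0 < \<sigma>" "\<sigma> < \<rho>"
  obtains g' where "\<And>y. y \<in> verts (X n) \<Longrightarrow> g' y = g y"
    "\<And>w y. w \<in> arcs (X n) \<Longrightarrow> g (tail (X n) w) = 0 \<Longrightarrow> g (head (X n) w) = 0 \<Longrightarrow> g' (pl n w y) = 0"
    "Xi_energy (Suc n) x g' \<le> Xi_energy n x g / \<sigma>"
proof -
  have "\<exists>h. h (bp i) = 1 \<and> h (bm i) = 0 \<and> rule_energy i x h < 1 / (\<sigma> * x $ i)" for i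
  proof -
    have "conductance i x = 1 / (\<rho> * x $ i)"
      using \<rho>[of i] by (metis mult_eq_0_iff nonzero_eq_divide_eq zero_neq_one)
    also have "\<dots> < 1 / (\<sigma> * x $ i)"
      using x[of i] \<sigma> by (intro divide_strict_left_mono mult_strict_right_mono) auto
    finally show ?thesis using conductance_approx[OF x] by metis
  qed
  then obtain h where h: "\<And>i. h i (bp i) = 1" "\<And>i. h i (bm i) = 0"
    "\<And>i. rule_energy i x (h i) < 1 / (\<sigma> * x $ i)"
    by metis
  define H where "H w y = g (head (X n) w) + (g (tail (X n) w) - g (head (X n) w)) * h (ac w) y" for w y
  obtain g' where g': "\<And>y. y \<in> verts (X n) \<Longrightarrow> g' y = g y"
    "\<And>w y. w \<in> arcs (X n) \<Longrightarrow> g' (pl n w y) = H w y"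
    by (rule Xi_extend[of n H g]) (auto simp: H_def h)
  have "Xi_energy (Suc n) x g' \<le> (\<Sum>w\<in>arcs (X n).
      (g (tail (X n) w) - g (head (X n) w))\<^sup>2 * (1 / (\<sigma> * x $ ac w)))"
    unfolding Xi_energy_Suc
  proof (rule sum_mono)
    fix w assume w: "w \<in> arcs (X n)"
    have "rule_energy (ac w) x (\<lambda>y. g' (pl n w y))
        = (g (tail (X n) w) - g (head (X n) w))\<^sup>2 * rule_energy (ac w) x (h (ac w))"
      unfolding g'(2)[OF w] H_def by (rule energy_affine)
    also have "\<dots> \<le> (g (tail (X n) w) - g (head (X n) w))\<^sup>2 * (1 / (\<sigma> * x $ ac w))"
      using h(3) by (intro mult_left_mono) (auto intro: less_imp_le)
    finally show "rule_energy (ac w) x (\<lambda>y. g' (pl n w y)) \<le> \<dots>" .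
  qed
  also have "\<dots> = Xi_energy n x g / \<sigma>"
    unfolding energy_def sum_divide_distrib by (simp add: mult.commute)
  finally show ?thesis using that[of g'] g' unfolding H_def by simp
qed

text \<open>Iterates the previous extension from the indicator of \<open>v\<close>: each level
  divides the energy bound by \<open>\<sigma>\<close>, and the nonzero values spread no further than
  \<open>near\<close>.\<close>

lemma localized_potential:
  assumes x: "\<And>j. 0 < x $ j" and \<rho>: "\<And>i. conductance i x * (\<rho> * x $ i) = 1"
    and \<sigma>: "0 < \<sigma>" "\<sigma> < \<rho>" and v: "v \<in> verts (X k)"
  shows "\<exists>g. g v = 1 \<and> (\<forall>y\<in>verts (X (k + m)) - near k v m. g y = 0) \<and>
    Xi_energy (k + m) x g \<le> Xi_energy k x (\<lambda>y. if y = v then 1 else 0) / \<sigma> ^ m"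
proof (induction m)
  case 0
  show ?case by (intro exI[of _ "\<lambda>y. if y = v then 1 else 0"]) auto
next
  case (Suc m)
  then obtain g where g: "g v = 1" "\<And>y. y \<in> verts (X (k + m)) \<Longrightarrow> y \<notin> near k v m \<Longrightarrow> g y = 0"
    "Xi_energy (k + m) x g \<le> Xi_energy k x (\<lambda>y. if y = v then 1 else 0) / \<sigma> ^ m"
    by blast
  obtain g' where g': "\<And>y. y \<in> verts (X (k + m)) \<Longrightarrow> g' y = g y"
    "\<And>w y. w \<in> arcs (X (k + m)) \<Longrightarrow> g (tail (X (k + m)) w) = 0 \<Longrightarrow> g (head (X (k + m)) w) = 0
      \<Longrightarrow> g' (pl (k + m) w y) = 0"
    "Xi_energy (Suc (k + m)) x g' \<le> Xi_energy (k + m) x g / \<sigma>"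
    using Xi_energy_extend[OF x \<rho> \<sigma>] by blast
  show ?case
  proof (intro exI[of _ g'] conjI ballI)
    show "g' v = 1" using g(1) g'(1) v verts_Xi_mono[of k "k + m"] by auto
  next
    fix y assume "y \<in> verts (X (k + Suc m)) - near k v (Suc m)"
    then have y: "y \<in> verts (X (k + Suc m))" "y \<notin> near k v (Suc m)" by auto
    show "g' y = 0"
    proof (cases "y \<in> verts (X (k + m))")
      case True
      then show ?thesis using g(2) g'(1) y(2) by simp
    next
      case False
      then obtain w z where w: "w \<in> arcs (X (k + m))" "z \<in> verts (R (ac w))" "y = pl (k + m) w z"
        using y(1) by (auto simp: verts_Xi_Suc)
      then have "tail (X (k + m)) w \<notin> near k v m" "head (X (k + m)) w \<notin> near k v m"
        using y(2) by auto
      then show ?thesis using w g(2) g'(2) tail_in_Xi head_in_Xi by simp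
    qed
  next
    have "Xi_energy (k + m) x g / \<sigma> \<le> Xi_energy k x (\<lambda>y. if y = v then 1 else 0) / \<sigma> ^ m / \<sigma>"
      using g(3) \<sigma>(1) by (intro divide_right_mono) auto
    then show "Xi_energy (k + Suc m) x g' \<le> Xi_energy k x (\<lambda>y. if y = v then 1 else 0) / \<sigma> ^ Suc m"
      using g'(3) by (simp add: mult.commute)
  qed
qed

section \<open>The two implications\<close>

lemma diam_ge_1: "1 \<le> diam"
  using diam by simp

lemma not_recurrent_if_eigenvalue_le_1:
  assumes "positive_eigenvalue (resistance_map S) \<le> 1"
  shows "\<not> recurrent S"
proof
  assume rec: "recurrent S"
  define \<rho> where "\<rho> = positive_eigenvalue (resistance_map S)"
  obtain x where x: "\<And>j. 0 < x $ j" and \<rho>: "0 < \<rho>" "\<And>i. conductance i x * (\<rho> * x $ i) = 1"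
    using resistance_eigenvector unfolding \<rho>_def by blast
  \<comment> \<open>Chosen so that \<open>r\<close> times the eccentricity of \<open>V_plus\<close>
    is at most \<open>lo n\<close>; thus \<open>V_minus\<close> lies outside the open ball at every
    level.\<close>
  define r where "r = 1 / real (diam + diam\<^sup>2)"
  have "1 \<le> diam\<^sup>2" using diam_ge_1 by (rule one_le_power)
  then have "1 < real (diam + diam\<^sup>2)" using diam_ge_1 by linarith
  then have r: "0 < r" "r < 1" unfolding r_def by auto
  define b where "b = Min (range (\<lambda>j. x $ j))"
  have b: "b \<le> x $ j" for j unfolding b_def by (rule Min_le) auto
  have "b \<in> range (\<lambda>j. x $ j)" unfolding b_def by (rule Min_in) auto
  then have bpos: "0 < b" using x by auto
  \<comment> \<open>The energy bound for \<open>\<rho> \<le> 1\<close> after passing from the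
    resistances given by \<open>x\<close> to unit ones, which costs the least coordinate
    \<open>b\<close>.\<close>
  define c where "c = b / x $ init_colour S"
  have c: "0 < c" unfolding c_def using bpos x by simp
  define T where "T n = verts (X n) - graph_ball (X n) V_plus
      (r * real (Max (graph_dist (X n) V_plus ` verts (X n))))" for n
  have "eff_resistance (X n) (\<lambda>_. 1) {V_plus} (T n) \<le> ereal (1 / c)" for n
  proof -
    have "Max (graph_dist (X n) V_plus ` verts (X n)) \<le> (diam + diam\<^sup>2) * lo n"
      using graph_dist_V_plus_le[of _ n] fin_digraph.finite_verts[OF fin_Xi, of n]
        Xi_endpoints(1)[of n]
      by (intro Max.boundedI) auto
    then have "real (Max (graph_dist (X n) V_plus ` verts (X n))) \<le> real (diam + diam\<^sup>2) * real (lo n)"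
      by (simp only: of_nat_le_iff flip: of_nat_mult)
    then have "r * real (Max (graph_dist (X n) V_plus ` verts (X n))) \<le> real (lo n)"
      unfolding r_def using diam_ge_1 by (simp add: divide_le_eq mult.commute add_pos_nonneg)
    also have "\<dots> \<le> real (graph_dist (X n) V_plus V_minus)" using graph_dist_endpoints by simp
    finally have "V_minus \<in> T n" unfolding T_def graph_ball_def using Xi_endpoints by simp
    have "ereal c \<le> (INF f\<in>{f. (\<forall>y\<in>{V_plus}. f y = 1) \<and> (\<forall>y\<in>T n. f y = 0)}.
        ereal (energy (X n) (\<lambda>_. 1) f))"
    proof (rule INF_greatest)
      fix f :: "('v, 'e) xvertex \<Rightarrow> real"
      assume "f \<in> {f. (\<forall>y\<in>{V_plus}. f y = 1) \<and> (\<forall>y\<in>T n. f y = 0)}"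
      then have f: "f V_plus = 1" "f V_minus = 0" using \<open>V_minus \<in> T n\<close> by auto
      have "\<rho> ^ n \<le> 1" using \<rho>(1) assms unfolding \<rho>_def by (simp add: power_le_one)
      then have "1 / x $ init_colour S \<le> 1 / (\<rho> ^ n * x $ init_colour S)"
        using \<rho>(1) x[of "init_colour S"] by (intro divide_left_mono) (auto simp: mult_le_cancel_right1)
      also have "\<dots> \<le> Xi_energy n x f" using Xi_energy_ge[OF x \<rho> f] .
      also have "\<dots> \<le> energy (X n) (\<lambda>_. b * 1) f" using b bpos by (intro energy_antimono) auto
      also have "\<dots> = energy (X n) (\<lambda>_. 1) f / b" by (rule energy_scale)
      finally have "c \<le> energy (X n) (\<lambda>_. 1) f"
        unfolding c_def using bpos by (simp add: pos_le_divide_eq mult.commute)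
      then show "ereal c \<le> ereal (energy (X n) (\<lambda>_. 1) f)" by simp
    qed
    then have "eff_resistance (X n) (\<lambda>_. 1) {V_plus} (T n) \<le> inverse (ereal c)"
      unfolding eff_resistance_def using c by (intro ereal_inverse_antimono) auto
    then show ?thesis using c by (simp add: divide_inverse)
  qed
  then have "liminf (\<lambda>n. eff_resistance (X n) (\<lambda>_. 1) {V_plus} (T n)) \<le> liminf (\<lambda>_. ereal (1 / c))"
    by (intro Liminf_mono) simp
  moreover have "liminf (\<lambda>n. eff_resistance (X n) (\<lambda>_. 1) {V_plus} (T n)) = \<infinity>"
    using rec r Xi_endpoints(1) unfolding recurrent_def Xi_verts_def T_def Let_def by blast
  ultimately show False by (simp add: Liminf_const)
qed

lemma recurrent_if_eigenvalue_gt_1: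
  assumes "1 < positive_eigenvalue (resistance_map S)"
  shows "recurrent S"
  unfolding recurrent_def
proof (intro ballI allI impI)
  fix v r assume "v \<in> Xi_verts S" and "0 < r \<and> r < (1 :: real)"
  then have r: "0 < r" by simp
  define \<rho> where "\<rho> = positive_eigenvalue (resistance_map S)"
  obtain x where x: "\<And>j. 0 < x $ j" and "0 < \<rho>" and \<rho>: "\<And>i. conductance i x * (\<rho> * x $ i) = 1"
    using resistance_eigenvector unfolding \<rho>_def by blast
  \<comment> \<open>Room below \<open>\<rho>\<close> for near-optimal extensions, while energies
    still decay geometrically.\<close>
  obtain \<sigma> where \<sigma>: "1 < \<sigma>" "\<sigma> < \<rho>" using assms dense unfolding \<rho>_def by blast
  obtain m0 where m0: "v \<in> verts (X m0)" using \<open>v \<in> Xi_verts S\<close> unfolding Xi_verts_def by blast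
  \<comment> \<open>Vertices in \<open>near\<close> are within
    \<open>diam\<^sup>2 * lo (n - k)\<close> of \<open>v\<close>, and the eccentricity is at least
    \<open>2 ^ k * lo (n - k) / 2\<close>; this power makes the former less than \<open>r\<close>
    times the latter.\<close>
  obtain k0 where k0: "2 * real (diam\<^sup>2) / r < 2 ^ k0" using real_arch_pow[of 2] by auto
  define k where "k = max m0 k0"
  have vk: "v \<in> verts (X k)" using m0 verts_Xi_mono[of m0 k] unfolding k_def by auto
  have k: "2 * real (diam\<^sup>2) < r * 2 ^ k"
  proof -
    have "2 * real (diam\<^sup>2) < r * 2 ^ k0" using k0 r by (simp add: divide_less_eq mult.commute)
    also have "\<dots> \<le> r * 2 ^ k"
      using r unfolding k_def by (intro mult_left_mono power_increasing) auto
    finally show ?thesis .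
  qed
  define M where "M n = Max (graph_dist (X n) v ` verts (X n))" for n
  define T where "T n = verts (X n) - graph_ball (X n) v (r * real (M n))" for n
  have near_T: "y \<notin> T n" if n: "k \<le> n" and y: "y \<in> near k v (n - k)" for n y
  proof
    assume "y \<in> T n"
    then have far: "r * real (M n) \<le> real (graph_dist (X n) v y)"
      unfolding T_def graph_ball_def by auto
    have vn: "v \<in> verts (X n)" using vk verts_Xi_mono[OF n] by blast
    have "2 ^ k * lo (n - k) \<le> lo n" using power_lo[of k "n - k"] n by simp
    also have "\<dots> \<le> 2 * M n" using eccentricity_ge[OF vn] unfolding M_def .
    finally have "real (2 ^ k * lo (n - k)) \<le> real (2 * M n)" by (simp only: of_nat_le_iff)
    then have "2 ^ k * real (lo (n - k)) \<le> 2 * real (M n)" by simp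
    then have "r * (2 ^ k * real (lo (n - k))) \<le> r * (2 * real (M n))"
      using r by (intro mult_left_mono) auto
    moreover have "real (graph_dist (X n) v y) \<le> real (diam\<^sup>2 * lo (n - k))"
      using graph_dist_near[OF vn n y] by (simp only: of_nat_le_iff)
    ultimately have "r * 2 ^ k * real (lo (n - k)) \<le> 2 * real (diam\<^sup>2) * real (lo (n - k))"
      using far unfolding of_nat_mult by linarith
    moreover have "2 * real (diam\<^sup>2) * real (lo (n - k)) < r * 2 ^ k * real (lo (n - k))"
      by (rule mult_strict_right_mono[OF k]) (use lo_pos[of "n - k"] in simp)
    ultimately show False by linarith
  qed
  \<comment> \<open>\<open>k\<close> stays fixed while \<open>n\<close> grows, so \<open>C\<close>
    is a constant.\<close>
  define C where "C = Xi_energy k x (\<lambda>y. if y = v then 1 else 0)"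
  have C0: "0 \<le> C" unfolding C_def using x by (intro energy_nonneg) (simp add: less_imp_le)
  define b where "b = Max (range (\<lambda>j. x $ j))"
  have b: "x $ j \<le> b" for j unfolding b_def by (rule Max_ge) auto
  then have bpos: "0 < b" using x by (meson less_le_trans)
  have bound: "ereal (\<sigma> ^ m / (b * (C + 1))) \<le> eff_resistance (X (k + m)) (\<lambda>_. 1) {v} (T (k + m))" for m
  proof -
    obtain g where g: "g v = 1" "\<And>y. y \<in> verts (X (k + m)) \<Longrightarrow> y \<notin> near k v m \<Longrightarrow> g y = 0"
      "Xi_energy (k + m) x g \<le> C / \<sigma> ^ m"
      using localized_potential[OF x \<rho> _ \<sigma>(2) vk, of m] \<sigma>(1) unfolding C_def by fastforce
    have "g y = 0" if "y \<in> T (k + m)" for y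
      using that g(2) near_T[of "k + m" y] unfolding T_def by auto
    then have "(INF f\<in>{f. (\<forall>y\<in>{v}. f y = 1) \<and> (\<forall>y\<in>T (k + m). f y = 0)}.
        ereal (energy (X (k + m)) (\<lambda>_. 1) f)) \<le> ereal (energy (X (k + m)) (\<lambda>_. 1) g)"
      using g(1) by (intro INF_lower) auto
    also have "energy (X (k + m)) (\<lambda>_. 1) g \<le> b * (C + 1) / \<sigma> ^ m"
    proof -
      have "energy (X (k + m)) (\<lambda>_. 1) g / b = energy (X (k + m)) (\<lambda>_. b * 1) g"
        by (rule energy_scale[symmetric])
      also have "\<dots> \<le> Xi_energy (k + m) x g" using b x by (intro energy_antimono) auto
      also have "\<dots> \<le> C / \<sigma> ^ m" by (rule g(3))
      \<comment> \<open>The summand 1 keeps the bound positive, so that its inverse is finite even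
        if \<open>C\<close> is 0.\<close>
      also have "\<dots> \<le> (C + 1) / \<sigma> ^ m" using \<sigma>(1) by (intro divide_right_mono) auto
      finally show ?thesis using bpos by (simp add: pos_divide_le_eq mult.commute)
    qed
    finally have "inverse (ereal (b * (C + 1) / \<sigma> ^ m)) \<le> eff_resistance (X (k + m)) (\<lambda>_. 1) {v} (T (k + m))"
      unfolding eff_resistance_def
      by (intro ereal_inverse_antimono INF_greatest) (auto intro!: energy_nonneg)
    moreover have "inverse (ereal (q / s)) = ereal (s / q)" if "0 < q" "0 < s" for q s :: real
      using that by (simp add: inverse_eq_divide)
    then have "inverse (ereal (b * (C + 1) / \<sigma> ^ m)) = ereal (\<sigma> ^ m / (b * (C + 1)))"
      using bpos C0 \<sigma>(1) by simp
    ultimately show ?thesis by (simp only:)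
  qed
  have "ereal B \<le> liminf (\<lambda>n. eff_resistance (X n) (\<lambda>_. 1) {v} (T n))" for B
  proof (rule Liminf_bounded)
    obtain m1 where m1: "B * (b * (C + 1)) < \<sigma> ^ m1" using real_arch_pow[OF \<sigma>(1)] by blast
    show "\<forall>\<^sub>F n in sequentially. ereal B \<le> eff_resistance (X n) (\<lambda>_. 1) {v} (T n)"
      using eventually_ge_at_top[of "k + m1"]
    proof eventually_elim
      case (elim n)
      have "B * (b * (C + 1)) \<le> \<sigma> ^ m1" using m1 by simp
      also have "\<dots> \<le> \<sigma> ^ (n - k)" using elim \<sigma>(1) by (intro power_increasing) auto
      finally have "B \<le> \<sigma> ^ (n - k) / (b * (C + 1))" using bpos C0 by (subst pos_le_divide_eq) auto
      then have "ereal B \<le> ereal (\<sigma> ^ (n - k) / (b * (C + 1)))" by simp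
      also have "\<dots> \<le> eff_resistance (X n) (\<lambda>_. 1) {v} (T n)" using bound[of "n - k"] elim by simp
      finally show ?case .
    qed
  qed
  then show "liminf (\<lambda>n. let G = X n in eff_resistance G (\<lambda>_. 1) {v}
      (verts G - graph_ball G v (r * real (Max (graph_dist G v ` verts G))))) = \<infinity>"
    unfolding Let_def T_def M_def by (rule ereal_top)
qed

end

theorem proposition2p21:
  fixes S :: "('v, 'e, 'k::finite) eigs_data"
  assumes "eigs S"
    and "canonical S"
    and "distance_positive S"
    and "degree_primitive S"
  shows "recurrent S \<longleftrightarrow> 1 < positive_eigenvalue (resistance_map S)"
proof -
  interpret distance_positive_eigs S using assms(1,3) by unfold_locales
  show ?thesis using recurrent_if_eigenvalue_gt_1 not_recurrent_if_eigenvalue_le_1 by (meson linorder_not_less)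
qed

end
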